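(* Let $H,K$ be complex Hilbert spaces and $(\Sigma,\mathcal H,\rho)$ a measure space. Suppose that $F:\Sigma\to B(H;K)$ is pointwise Pettis integrable. Then, for all $p\in[1,\infty]$, $$\Big\|\int_\Sigma F\,d\rho\Big\|_{\mathcal S_p}\le\underline{\int_\Sigma}\|F\|_{\mathcal S_p}\,d\rho.$$ In particular, if the right hand side is finite, then $\int_\Sigma F\,d\rho\in\mathcal S_p(H;K)$.
   Context: Hilbert spaces are not assumed separable; inner products are linear in the first argument. For $A\in B(H;K)$ and $p\in[1,\infty)$, $\|A\|_{\mathcal S_p}=\big(\sum_{e\in\mathcal E}\langle|A|^pe,e\rangle_H\big)^{1/p}\in[0,\infty]$, where $|A|^p=(A^*A)^{p/2}$ and $\mathcal E$ is any orthonormal basis of $H$; $\mathcal S_p(H;K)=\{A:\|A\|_{\mathcal S_p}<\infty\}$. $\mathcal S_\infty(H;K)=B(H;K)$ with the operator norm. $F:\Sigma\to B(H;K)$ is pointwise Pettis integrable if $\sigma\mapsto\langle F(\sigma)h,k\rangle_K$ is measurable with $\int_\Sigma|\langle F(\sigma)h,k\rangle_K|\,\rho(d\sigma)<\infty$ for all $h\in H,k\in K$; then $\int_\Sigma F\,d\rho\in B(H;K)$ is the (existing, unique) bounded operator with $\langle(\int_\Sigma F\,d\rho)h,k\rangle_K=\int_\Sigma\langle F(\sigma)h,k\rangle_K\,\rho(d\sigma)$ for all $h,k$. Lower integral of an arbitrary function $h:\Sigma\to[0,\infty]$: $\underline{\int_\Sigma}h\,d\rho=\sup\{\int_\Sigma\tilde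 h\,d\rho:\tilde h\le h\ \rho\text{-a.e.},\ \tilde h:\Sigma\to[0,\infty]\text{ measurable}\}$. *)

theory Defs
  imports "HOL-Analysis.Analysis"
begin

text \<open>
  A complex inner product space is presented as a real one (this provides norm and topology)
  together with a complex scalar multiplication and a complex inner product, linear in its first
  argument, whose real part is the given real inner product. Hence \<open>norm x ^ 2 = cinner x x\<close>, and
  every complex inner product space arises in exactly one way.
\<close>

class complex_inner = real_inner +
  fixes scaleC :: "complex \<Rightarrow> 'a \<Rightarrow> 'a" (infixr \<open>*\<^sub>C\<close> 75)
    and cinner :: "'a \<Rightarrow> 'a \<Rightarrow> complex"
  assumes scaleC_add_right: "c *\<^sub>C (x + y) = c *\<^sub>C x + c *\<^sub>C y"
    and scaleC_add_left: "(c + d) *\<^sub>C x = c *\<^sub>C x + d *\<^sub>C x"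
    and scaleC_scaleC: "c *\<^sub>C d *\<^sub>C x = (c * d) *\<^sub>C x"
    and scaleR_scaleC: "r *\<^sub>R x = complex_of_real r *\<^sub>C x"
    and cinner_commute: "cinner x y = cnj (cinner y x)"
    and cinner_add_left: "cinner (x + y) z = cinner x z + cinner y z"
    and cinner_scaleC_left: "cinner (c *\<^sub>C x) y = c * cinner x y"
    and Re_cinner: "Re (cinner x y) = inner x y"

class complex_hilbert = complex_inner + complete_space

lemma module_scaleC: "module (scaleC :: complex \<Rightarrow> 'a \<Rightarrow> 'a :: complex_inner)"
proof
  show "1 *\<^sub>C x = x" for x :: 'a
    using scaleR_scaleC[of 1 x] by simp
qed (simp_all add: scaleC_add_right scaleC_add_left scaleC_scaleC)

lemma cinner_self: "cinner x x = complex_of_real ((norm x)\<^sup>2)" for x :: "'a :: complex_inner"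
proof (rule complex_eqI)
  show "Im (cinner x x) = Im (complex_of_real ((norm x)\<^sup>2))"
    using arg_cong[OF cinner_commute[of x x], of Im] by simp
qed (simp add: Re_cinner power2_norm_eq_inner)

instantiation complex :: complex_hilbert
begin

definition scaleC_complex :: "complex \<Rightarrow> complex \<Rightarrow> complex"
  where "scaleC_complex c x = c * x"

definition cinner_complex :: "complex \<Rightarrow> complex \<Rightarrow> complex"
  where "cinner_complex x y = x * cnj y"

instance
  by standard
    (auto simp: scaleC_complex_def cinner_complex_def inner_complex_def algebra_simps scaleR_conv_of_real)

end

definition orthonormal_basis :: "'a :: complex_inner set \<Rightarrow> bool"
  where "orthonormal_basis E \<longleftrightarrow>
    (\<forall>e\<in>E. norm e = 1) \<and> (\<forall>e\<in>E. \<forall>e'\<in>E. e \<noteq> e' \<longrightarrow> cinner e e' = 0) \<and>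
    closure (module.span scaleC E) = UNIV"

text \<open>
  The type \<open>'a \<Rightarrow>\<^sub>L 'b\<close> contains all bounded real-linear maps; \<open>B(H;K)\<close> is its subset of
  complex-linear ones, with the same operator norm.
\<close>

definition bounded_ops :: "('a :: complex_inner \<Rightarrow>\<^sub>L 'b :: complex_inner) set"
  where "bounded_ops = {A :: 'a \<Rightarrow>\<^sub>L 'b. \<forall>c x. A (c *\<^sub>C x) = c *\<^sub>C A x}"

definition hilbert_adjoint ::
    "('a :: complex_inner \<Rightarrow>\<^sub>L 'b :: complex_inner) \<Rightarrow> 'b \<Rightarrow>\<^sub>L 'a"
  where "hilbert_adjoint A =
    (THE B. B \<in> bounded_ops \<and> (\<forall>x y. cinner (A x) y = cinner x (B y)))"

definition op_poly :: "real poly \<Rightarrow> ('a :: real_normed_vector \<Rightarrow>\<^sub>L 'a) \<Rightarrow> 'a \<Rightarrow>\<^sub>L 'a"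
  where "op_poly q T = (\<Sum>i\<le>degree q. coeff q i *\<^sub>R (((o\<^sub>L) T ^^ i) id_blinfun))"

text \<open>
  Continuous functional calculus \<open>f(T)\<close> of a positive operator \<open>T\<close>, for \<open>f\<close> continuous on
  \<open>[0, \<parallel>T\<parallel>]\<close>, an interval containing the spectrum: the common operator norm limit of \<open>q\<^sub>n(T)\<close>
  over all sequences of polynomials \<open>q\<^sub>n\<close> that converge to \<open>f\<close> uniformly on that interval.
\<close>

definition fun_calc :: "(real \<Rightarrow> real) \<Rightarrow> ('a :: real_normed_vector \<Rightarrow>\<^sub>L 'a) \<Rightarrow> 'a \<Rightarrow>\<^sub>L 'a"
  where "fun_calc f T =
    (THE S. \<forall>q. uniform_limit {0..norm T} (\<lambda>n. poly (q n)) f sequentially \<longrightarrow>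
                (\<lambda>n. op_poly (q n) T) \<longlonglongrightarrow> S)"

definition abs_op_powr ::
    "('a :: complex_inner \<Rightarrow>\<^sub>L 'b :: complex_inner) \<Rightarrow> real \<Rightarrow> 'a \<Rightarrow>\<^sub>L 'a"
  where "abs_op_powr A p = fun_calc (\<lambda>t. t powr (p / 2)) (hilbert_adjoint A o\<^sub>L A)"

text \<open>Only used for \<open>r > 0\<close>.\<close>

definition ennreal_powr :: "ennreal \<Rightarrow> real \<Rightarrow> ennreal"
  where "ennreal_powr x r = (if x = \<infinity> then \<infinity> else ennreal (enn2real x powr r))"

text \<open>
  The summands \<open>\<langle>|A|^p e, e\<rangle>\<close> are nonnegative reals, so nothing is lost by \<open>ennreal \<circ> Re\<close>;
  the sum over the (possibly uncountable) basis is unordered and does not depend on the basis.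
\<close>

definition schatten_norm ::
    "ennreal \<Rightarrow> ('a :: complex_hilbert \<Rightarrow>\<^sub>L 'b :: complex_hilbert) \<Rightarrow> ennreal"
  where "schatten_norm p A =
    (if p = \<infinity> then ennreal (norm A)
     else ennreal_powr
       (\<Sum>\<^sub>\<infinity>e\<in>(SOME E. orthonormal_basis E).
          ennreal (Re (cinner (abs_op_powr A (enn2real p) e) e)))
       (1 / enn2real p))"

text \<open>For \<open>p = \<infinity>\<close> the norm is always finite and this is all of \<open>B(H;K)\<close>.\<close>

definition schatten_class ::
    "ennreal \<Rightarrow> ('a :: complex_hilbert \<Rightarrow>\<^sub>L 'b :: complex_hilbert) set"
  where "schatten_class p = {A \<in> bounded_ops. schatten_norm p A < \<infinity>}"

definition pointwise_Pettis_integrable ::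
    "'s measure \<Rightarrow> ('s \<Rightarrow> 'a :: complex_hilbert \<Rightarrow>\<^sub>L 'b :: complex_hilbert) \<Rightarrow> bool"
  where "pointwise_Pettis_integrable M F \<longleftrightarrow> (\<forall>h k. integrable M (\<lambda>s. cinner (F s h) k))"

definition Pettis_integral ::
    "'s measure \<Rightarrow> ('s \<Rightarrow> 'a :: complex_hilbert \<Rightarrow>\<^sub>L 'b :: complex_hilbert) \<Rightarrow> 'a \<Rightarrow>\<^sub>L 'b"
  where "Pettis_integral M F =
    (THE S. S \<in> bounded_ops \<and> (\<forall>h k. cinner (S h) k = (LINT s|M. cinner (F s h) k)))"

definition lower_integral :: "'s measure \<Rightarrow> ('s \<Rightarrow> ennreal) \<Rightarrow> ennreal"
  where "lower_integral M h =
    (SUP g\<in>{g \<in> borel_measurable M. AE s in M. g s \<le> h s}. \<integral>\<^sup>+ s. g s \<partial>M)"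

end

theory Submission
  imports Defs
begin

text \<open>
  The Schatten norm is a supremum of norms of finite systems of matrix elements: for
  \<open>1 \<le> r < \<infinity>\<close>, \<open>\<parallel>A\<parallel>\<^sub>r\<close> is the supremum of the \<open>\<ell>\<^sup>r\<close> norms of \<open>(\<langle>A e\<^sub>i, f\<^sub>i\<rangle>)\<^sub>i\<close> over all finite
  orthonormal families \<open>(e\<^sub>i)\<close>, \<open>(f\<^sub>i)\<close>. Matrix elements commute with the integral. Pairing them
  with the dual vector of \<open>(\<langle>(\<integral>F) e\<^sub>i, f\<^sub>i\<rangle>)\<^sub>i\<close> gives a measurable function of \<open>\<sigma>\<close> that is at most
  \<open>\<parallel>F(\<sigma>)\<parallel>\<^sub>r\<close> by Hoelder's inequality, so it competes in the lower integral, and its integral bounds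
  the \<open>\<ell>\<^sup>r\<close> norm for \<open>\<integral>F\<close> (\<open>Pettis_matrix_elements_le\<close>). For \<open>p = \<infinity>\<close> a single matrix element suffices.

  The two halves of the supremum formula are \<open>matrix_elements_le_trace\<close> and
  \<open>trace_le_matrix_elements\<close>. Both hold for noncompact \<open>A\<close> and rest on one finite-dimensional device,
  \<open>krylov_quadrature\<close>: let \<open>T = A\<^sup>* A\<close>, and compress \<open>T\<close> to the span of the vectors \<open>T\<^sup>i x\<close>, \<open>i \<le> n\<close>,
  \<open>x\<close> in a finite set \<open>X\<close>. The compression has an orthonormal eigenbasis \<open>D\<close>, its eigenvalues
  \<open>\<lambda>\<^sub>d = \<langle>T d, d\<rangle>\<close> lie in \<open>[0, \<parallel>T\<parallel>]\<close>, and \<open>q(T) x = \<Sum>\<^sub>d q(\<lambda>\<^sub>d) \<langle>x, d\<rangle> d\<close> holds exactly for polynomials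
  \<open>q\<close> of degree at most \<open>n\<close> and \<open>x \<in> X\<close>. Three facts follow.

  First, \<open>\<parallel>q(T)\<parallel> \<le> sup |q|\<close> over \<open>[0, \<parallel>T\<parallel>]\<close>, which makes the continuous functional calculus, and with it
  \<open>|A|\<^sup>r\<close>, well defined and positive.

  Second, since \<open>\<langle>A d, A d'\<rangle> = \<langle>T d, d'\<rangle>\<close>, the vectors \<open>A d\<close> are orthogonal. Testing \<open>A\<close> on \<open>D\<close> against
  the normalised \<open>A d\<close> produces \<open>\<Sum>\<^sub>d \<lambda>\<^sub>d\<^bsup>r/2\<^esup>\<close>, and this is at least \<open>\<Sum>\<^sub>e \<langle>|A|\<^sup>r e, e\<rangle>\<close> over a given finite
  part of a basis, up to the error of a polynomial approximation of \<open>t\<^bsup>r/2\<^esup>\<close>.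

  Third, the singular value decomposition of a compression bounds \<open>|\<langle>A e, f\<rangle>|\<^sup>r\<close>, up to a small
  error, by the mean of
  \<open>\<langle>|A|\<^sup>r e, e\<rangle>\<close> and \<open>\<langle>|A|\<^sup>r C f, C f\<rangle>\<close>, where \<open>C\<close> is the adjoint of an approximate polar factor
  (\<open>matrix_element_powr_bound\<close>). As \<open>C\<close> is a contraction with a contractive adjoint, it maps
  orthonormal families to families that satisfy Bessel's inequality, and for these the sum of the
  quadratic form of \<open>|A|\<^sup>r\<close> is at most its trace (\<open>bessel_sum_le_trace\<close>).

  The integral itself exists because \<open>\<parallel>\<langle>F h, k\<rangle>\<parallel>\<close> in \<open>L\<^sup>1\<close> is a bounded seminorm in \<open>h\<close> and in \<open>k\<close>, by Fatou's
  lemma and Baire's theorem, so that the Riesz representation applies (\<open>Pettis_integral\<close>).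
\<close>

section \<open>Complex inner product spaces and orthonormal families\<close>

instance complex_hilbert \<subseteq> banach ..

lemma cinner_add_right: "cinner x (y + z) = cinner x y + cinner x z"
  for x :: "'a :: complex_inner"
  by (metis cinner_add_left cinner_commute complex_cnj_add)

lemma cinner_scaleC_right: "cinner x (c *\<^sub>C y) = cnj c * cinner x y"
  for x :: "'a :: complex_inner"
  by (metis cinner_scaleC_left cinner_commute complex_cnj_mult)

lemma cinner_zero_left [simp]: "cinner 0 y = 0" for y :: "'a :: complex_inner"
  using cinner_add_left[of 0 0 y] by simp

lemma cinner_zero_right [simp]: "cinner x 0 = 0" for x :: "'a :: complex_inner"
  using cinner_add_right[of x 0 0] by simp

lemma cinner_minus_left: "cinner (- x) y = - cinner x y" for x :: "'a :: complex_inner"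
  using cinner_add_left[of x "- x" y] by (simp add: add_eq_0_iff)

lemma cinner_minus_right: "cinner x (- y) = - cinner x y" for x :: "'a :: complex_inner"
  using cinner_add_right[of x y "- y"] by (simp add: add_eq_0_iff)

lemma cinner_diff_left: "cinner (x - y) z = cinner x z - cinner y z"
  for x :: "'a :: complex_inner"
  using cinner_add_left[of x "- y" z] by (simp add: cinner_minus_left)

lemma cinner_diff_right: "cinner x (y - z) = cinner x y - cinner x z"
  for x :: "'a :: complex_inner"
  using cinner_add_right[of x y "- z"] by (simp add: cinner_minus_right)

lemma cinner_sum_left: "cinner (\<Sum>i\<in>I. f i) y = (\<Sum>i\<in>I. cinner (f i) y)"
  for y :: "'a :: complex_inner"
  by (induction I rule: infinite_finite_induct) (simp_all add: cinner_add_left)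

lemma cinner_sum_right: "cinner x (\<Sum>i\<in>I. f i) = (\<Sum>i\<in>I. cinner x (f i))"
  for x :: "'a :: complex_inner"
  by (induction I rule: infinite_finite_induct) (simp_all add: cinner_add_right)

lemma cinner_scaleR_left: "cinner (r *\<^sub>R x) y = of_real r * cinner x y"
  for x :: "'a :: complex_inner"
  by (simp add: scaleR_scaleC cinner_scaleC_left)

lemma cinner_scaleR_right: "cinner x (r *\<^sub>R y) = of_real r * cinner x y"
  for x :: "'a :: complex_inner"
  by (simp add: scaleR_scaleC cinner_scaleC_right)

lemma cinner_eq_0_sym: "cinner x y = 0 \<longleftrightarrow> cinner y x = 0" for x :: "'a :: complex_inner"
  by (metis cinner_commute complex_cnj_zero)

lemma norm_cinner_commute: "norm (cinner x y) = norm (cinner y x)"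
  for x :: "'a :: complex_inner"
  by (metis cinner_commute complex_mod_cnj)

lemma Re_cinner_self: "Re (cinner x x) = (norm x)\<^sup>2" for x :: "'a :: complex_inner"
  by (simp add: cinner_self)

lemma scaleC_one [simp]: "1 *\<^sub>C x = x" for x :: "'a :: complex_inner"
  using scaleR_scaleC[of 1 x] by simp

lemma scaleC_zero_left [simp]: "0 *\<^sub>C x = 0" for x :: "'a :: complex_inner"
  using scaleR_scaleC[of 0 x] by simp

lemma scaleC_zero_right [simp]: "c *\<^sub>C (0 :: 'a :: complex_inner) = 0"
  using scaleC_add_right[of c "0 :: 'a" 0] by simp

lemma scaleC_sum_right: "c *\<^sub>C (\<Sum>i\<in>I. f i) = (\<Sum>i\<in>I. c *\<^sub>C f i)"
  for f :: "'i \<Rightarrow> 'a :: complex_inner"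
  by (induction I rule: infinite_finite_induct) (simp_all add: scaleC_add_right)

lemma norm_scaleC: "norm (c *\<^sub>C x) = norm c * norm x" for x :: "'a :: complex_inner"
proof -
  have "cinner (c *\<^sub>C x) (c *\<^sub>C x) = of_real ((norm c)\<^sup>2 * (norm x)\<^sup>2)"
    using complex_norm_square[of c]
    by (simp add: cinner_scaleC_left cinner_scaleC_right cinner_self[of x])
  then have "(norm (c *\<^sub>C x))\<^sup>2 = (norm c * norm x)\<^sup>2"
    unfolding cinner_self of_real_eq_iff by (simp add: power_mult_distrib)
  then show ?thesis by (rule power2_eq_imp_eq) simp_all
qed

text \<open>The real Cauchy-Schwarz inequality, after rotating the first vector by a phase.\<close>

lemma norm_cinner_le: "norm (cinner x y) \<le> norm x * norm y" for x :: "'a :: complex_inner"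
proof (cases "cinner x y = 0")
  case False
  define z where "z = cinner x y"
  define c where "c = cnj z / of_real (norm z)"
  have nz: "norm z \<noteq> 0" using False by (simp add: z_def)
  have c1: "norm c = 1" using nz by (simp add: c_def norm_divide)
  have "c * z = (of_real (norm z) * of_real (norm z)) / of_real (norm z)"
    using complex_norm_square[of z] by (simp add: c_def power2_eq_square mult.commute)
  then have "c * z = of_real (norm z)" using nz by simp
  then have "norm z = Re (cinner (c *\<^sub>C x) y)" by (simp add: cinner_scaleC_left z_def)
  also have "\<dots> \<le> norm (c *\<^sub>C x) * norm y" by (simp add: Re_cinner norm_cauchy_schwarz)
  finally show ?thesis by (simp add: norm_scaleC c1 z_def)
qed simp

lemma bounded_bilinear_cinner:
  "bounded_bilinear (cinner :: 'a :: complex_inner \<Rightarrow> 'a \<Rightarrow> complex)"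
proof
  show "\<exists>K. \<forall>a b :: 'a. norm (cinner a b) \<le> norm a * norm b * K"
    using norm_cinner_le by (metis mult.right_neutral)
qed (simp_all add: cinner_add_left cinner_add_right cinner_scaleR_left cinner_scaleR_right
    scaleR_conv_of_real)

lemmas continuous_on_cinner [continuous_intros] =
  bounded_bilinear.continuous_on[OF bounded_bilinear_cinner]
lemmas tendsto_cinner [tendsto_intros] =
  bounded_bilinear.tendsto[OF bounded_bilinear_cinner]

lemma bounded_bilinear_scaleC:
  "bounded_bilinear (scaleC :: complex \<Rightarrow> 'a :: complex_inner \<Rightarrow> 'a)"
proof
  show "\<exists>K. \<forall>a (b :: 'a). norm (a *\<^sub>C b) \<le> norm a * norm b * K"
    using norm_scaleC by (metis mult.right_neutral order_refl)
qed (simp_all add: scaleC_add_left scaleC_add_right scaleR_scaleC scaleC_scaleC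
    scaleC_complex_def mult.commute)

lemmas continuous_on_scaleC [continuous_intros] =
  bounded_bilinear.continuous_on[OF bounded_bilinear_scaleC]

lemma cinner_ext: "(\<And>z. cinner x z = cinner y z) \<Longrightarrow> x = y" for x :: "'a :: complex_inner"
proof -
  assume *: "\<And>z. cinner x z = cinner y z"
  have "cinner (x - y) (x - y) = 0" by (simp add: cinner_diff_left *)
  then show ?thesis by (simp add: cinner_self)
qed

text \<open>The imaginary part of the complex inner product is a real part after rotation.\<close>

lemma Im_cinner: "Im (cinner x y) = inner x (\<i> *\<^sub>C y)" for x :: "'a :: complex_inner"
  by (simp add: Re_cinner[symmetric] cinner_scaleC_right)

definition orthonormal_on :: "'i set \<Rightarrow> ('i \<Rightarrow> 'a :: complex_inner) \<Rightarrow> bool"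
  where "orthonormal_on I u \<longleftrightarrow> (\<forall>i\<in>I. \<forall>j\<in>I. cinner (u i) (u j) = (if i = j then 1 else 0))"

definition proj_on :: "'i set \<Rightarrow> ('i \<Rightarrow> 'a :: complex_inner) \<Rightarrow> 'a \<Rightarrow> 'a"
  where "proj_on I u x = (\<Sum>i\<in>I. cinner x (u i) *\<^sub>C u i)"

lemma orthonormal_on_cinner:
  "orthonormal_on I u \<Longrightarrow> i \<in> I \<Longrightarrow> j \<in> I \<Longrightarrow> cinner (u i) (u j) = (if i = j then 1 else 0)"
  by (simp add: orthonormal_on_def)

lemma orthonormal_on_norm:
  assumes "orthonormal_on I u" "i \<in> I"
  shows "norm (u i) = 1"
proof -
  have "(norm (u i))\<^sup>2 = 1"
    using orthonormal_on_cinner[OF assms(1,2,2)] by (simp add: Re_cinner_self[symmetric])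
  then show ?thesis by (metis norm_ge_zero power2_eq_iff_nonneg one_power2 zero_le_one)
qed

lemma proj_on_add: "proj_on I u (x + y) = proj_on I u x + proj_on I u y"
  by (simp add: proj_on_def cinner_add_left scaleC_add_left sum.distrib)

lemma proj_on_scaleC: "proj_on I u (c *\<^sub>C x) = c *\<^sub>C proj_on I u x"
  by (simp add: proj_on_def cinner_scaleC_left scaleC_scaleC scaleC_sum_right)

lemma proj_on_diff: "proj_on I u (x - y) = proj_on I u x - proj_on I u y"
proof -
  have "proj_on I u (x - y) + proj_on I u y = proj_on I u x"
    by (simp flip: proj_on_add)
  then show ?thesis by (simp add: algebra_simps)
qed

lemma proj_on_zero [simp]: "proj_on I u 0 = 0"
  using proj_on_diff[of I u 0 0] by simp

lemma proj_on_sum: "proj_on I u (\<Sum>j\<in>J. f j) = (\<Sum>j\<in>J. proj_on I u (f j))"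
  by (induction J rule: infinite_finite_induct) (simp_all add: proj_on_add)

lemma cinner_orthonormal_sum:
  assumes "orthonormal_on I u" "finite I" "i \<in> I"
  shows "cinner (\<Sum>j\<in>I. c j *\<^sub>C u j) (u i) = c i"
proof -
  have "cinner (\<Sum>j\<in>I. c j *\<^sub>C u j) (u i) = (\<Sum>j\<in>I. if j = i then c j else 0)"
    unfolding cinner_sum_left cinner_scaleC_left
    by (rule sum.cong) (use assms in \<open>auto simp: orthonormal_on_cinner\<close>)
  then show ?thesis using assms by simp
qed

lemma cinner_proj_on:
  "orthonormal_on I u \<Longrightarrow> finite I \<Longrightarrow> i \<in> I \<Longrightarrow> cinner (proj_on I u x) (u i) = cinner x (u i)"
  unfolding proj_on_def by (rule cinner_orthonormal_sum)

lemma proj_on_orthonormal_sum: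
  "orthonormal_on I u \<Longrightarrow> finite I \<Longrightarrow> proj_on I u (\<Sum>j\<in>I. c j *\<^sub>C u j) = (\<Sum>j\<in>I. c j *\<^sub>C u j)"
  unfolding proj_on_def[of I u "\<Sum>j\<in>I. c j *\<^sub>C u j"] by (simp add: cinner_orthonormal_sum)

lemma proj_on_idem:
  "orthonormal_on I u \<Longrightarrow> finite I \<Longrightarrow> proj_on I u (proj_on I u x) = proj_on I u x"
  unfolding proj_on_def[of I u x] by (rule proj_on_orthonormal_sum)

lemma proj_on_member:
  "orthonormal_on I u \<Longrightarrow> finite I \<Longrightarrow> i \<in> I \<Longrightarrow> proj_on I u (u i) = u i"
  using proj_on_orthonormal_sum[of I u "\<lambda>j. if j = i then 1 else 0"]
  by (simp add: if_distrib[of "\<lambda>c. c *\<^sub>C _"] cong: if_cong)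

lemma cinner_orthonormal_sums:
  assumes "orthonormal_on I u" "finite I"
  shows "cinner (\<Sum>i\<in>I. a i *\<^sub>C u i) (\<Sum>i\<in>I. b i *\<^sub>C u i) = (\<Sum>i\<in>I. a i * cnj (b i))"
  by (simp add: cinner_sum_right cinner_scaleC_right cinner_orthonormal_sum[OF assms] mult.commute)

lemma norm_orthonormal_sum:
  assumes "orthonormal_on I u" "finite I"
  shows "(norm (\<Sum>i\<in>I. a i *\<^sub>C u i))\<^sup>2 = (\<Sum>i\<in>I. (norm (a i))\<^sup>2)"
proof -
  have "complex_of_real ((norm (\<Sum>i\<in>I. a i *\<^sub>C u i))\<^sup>2) = of_real (\<Sum>i\<in>I. (norm (a i))\<^sup>2)"
    using cinner_orthonormal_sums[OF assms, of a a]
    by (simp add: cinner_self complex_norm_square flip: of_real_power)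
  then show ?thesis by (simp only: of_real_eq_iff)
qed

lemma norm_proj_on:
  "orthonormal_on I u \<Longrightarrow> finite I \<Longrightarrow> (norm (proj_on I u x))\<^sup>2 = (\<Sum>i\<in>I. (norm (cinner x (u i)))\<^sup>2)"
  unfolding proj_on_def by (rule norm_orthonormal_sum)

lemma pythagoras: "cinner x y = 0 \<Longrightarrow> (norm (x + y))\<^sup>2 = (norm x)\<^sup>2 + (norm y)\<^sup>2"
  for x :: "'a :: complex_inner"
  using cinner_eq_0_sym[of x y]
  by (simp add: Re_cinner_self[symmetric] cinner_add_left cinner_add_right)

lemma cinner_residual_orthonormal:
  "orthonormal_on I u \<Longrightarrow> finite I \<Longrightarrow> i \<in> I \<Longrightarrow> cinner (x - proj_on I u x) (u i) = 0"
  by (simp add: cinner_diff_left cinner_proj_on)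

lemma cinner_residual_span:
  assumes "orthonormal_on I u" "finite I" "proj_on I u y = y"
  shows "cinner (x - proj_on I u x) y = 0"
proof -
  have "cinner (x - proj_on I u x) (proj_on I u y) = 0"
    unfolding proj_on_def[of I u y]
    by (simp add: cinner_sum_right cinner_scaleC_right cinner_residual_orthonormal assms)
  then show ?thesis by (simp add: assms)
qed

lemma norm_proj_on_le:
  assumes "orthonormal_on I u" "finite I"
  shows "norm (proj_on I u x) \<le> norm x"
proof -
  have "(norm x)\<^sup>2 = (norm (x - proj_on I u x))\<^sup>2 + (norm (proj_on I u x))\<^sup>2"
    using pythagoras[OF cinner_residual_span[OF assms proj_on_idem[OF assms]], of x x] by simp
  then have "(norm (proj_on I u x))\<^sup>2 \<le> (norm x)\<^sup>2" by simp
  then show ?thesis by (simp add: abs_le_square_iff[symmetric])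
qed

lemma bessel_inequality:
  "orthonormal_on I u \<Longrightarrow> finite I \<Longrightarrow> (\<Sum>i\<in>I. (norm (cinner x (u i)))\<^sup>2) \<le> (norm x)\<^sup>2"
  by (simp add: norm_proj_on[symmetric] norm_proj_on_le power_mono)

lemma cinner_proj_on_commute:
  assumes "orthonormal_on I u" "finite I"
  shows "cinner (proj_on I u x) y = cinner x (proj_on I u y)"
  by (simp add: proj_on_def cinner_sum_left cinner_sum_right cinner_scaleC_left cinner_scaleC_right
      cinner_commute[of y] mult.commute)

lemma proj_on_best_approximation:
  assumes "orthonormal_on I u" "finite I" "proj_on I u y = y"
  shows "norm (x - proj_on I u x) \<le> norm (x - y)"
proof -
  have "proj_on I u (proj_on I u x - y) = proj_on I u x - y"
    using assms by (simp add: proj_on_diff proj_on_idem)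
  from pythagoras[OF cinner_residual_span[OF assms(1,2) this], of x]
  have "(norm (x - proj_on I u x))\<^sup>2 \<le> (norm (x - y))\<^sup>2" by simp
  then show ?thesis by (simp add: abs_le_square_iff[symmetric])
qed

text \<open>The fixed points of a projection form the span of the family, so a larger family fixes more.\<close>

lemma proj_on_span_mono:
  assumes "proj_on I u x = x" "orthonormal_on J v" "finite J" "\<And>i. i \<in> I \<Longrightarrow> proj_on J v (u i) = u i"
  shows "proj_on J v x = x"
proof -
  have "proj_on J v (proj_on I u x) = proj_on I u x"
    unfolding proj_on_def[of I u x] proj_on_sum
    by (rule sum.cong) (simp_all add: proj_on_scaleC assms(4))
  then show ?thesis by (simp add: assms(1))
qed

lemma orthonormal_on_insert:
  assumes "orthonormal_on D (\<lambda>d. d)" "norm x = 1" "\<And>d. d \<in> D \<Longrightarrow> cinner x d = 0"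
  shows "orthonormal_on (insert x D) (\<lambda>d. d)"
proof -
  have "x \<notin> D" using assms(2) assms(3)[of x] cinner_self[of x] by auto
  moreover have "cinner d x = 0" if "d \<in> D" for d
    using assms(3)[OF that] cinner_eq_0_sym by blast
  moreover have "cinner x x = 1" by (simp add: cinner_self assms(2))
  ultimately show ?thesis using assms(1,3) by (simp add: orthonormal_on_def) metis
qed

text \<open>One step of Gram-Schmidt orthonormalisation.\<close>

lemma orthonormal_extend:
  assumes B: "finite B" "orthonormal_on B (\<lambda>b. b)" and neq: "proj_on B (\<lambda>b. b) x \<noteq> x"
  obtains e where "orthonormal_on (insert e B) (\<lambda>b. b)" "proj_on (insert e B) (\<lambda>b. b) x = x"
proof -
  let ?r = "x - proj_on B (\<lambda>b. b) x"
  define e where "e = (1 / norm ?r) *\<^sub>R ?r"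
  have r0: "norm ?r \<noteq> 0" using neq by simp
  have e1: "norm e = 1" using r0 by (simp add: e_def)
  have eB: "cinner e d = 0" if "d \<in> B" for d
    using cinner_residual_orthonormal[OF B(2,1) that, of x] by (simp add: e_def cinner_scaleR_left)
  have on: "orthonormal_on (insert e B) (\<lambda>b. b)" by (rule orthonormal_on_insert[OF B(2) e1 eB])
  let ?P = "proj_on (insert e B) (\<lambda>b. b)"
  have fin: "finite (insert e B)" using B by simp
  have "?P (proj_on B (\<lambda>b. b) x) = proj_on B (\<lambda>b. b) x"
    by (rule proj_on_span_mono[where I = B and u = "\<lambda>b. b"])
      (use B on fin in \<open>auto simp: proj_on_idem intro!: proj_on_member[where u = "\<lambda>b. b"]\<close>)
  moreover have "?P ?r = ?r"
  proof -
    have "?r = of_real (norm ?r) *\<^sub>C e" using r0 by (simp add: e_def scaleR_scaleC[symmetric])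
    moreover have "?P e = e" using proj_on_member[OF on fin, of e] by simp
    ultimately show ?thesis by (metis proj_on_scaleC)
  qed
  ultimately have "?P x = x" by (metis proj_on_add diff_add_cancel)
  with on that show ?thesis by blast
qed

lemma gram_schmidt:
  fixes X :: "'a :: complex_inner set"
  assumes "finite X"
  shows "\<exists>B. finite B \<and> orthonormal_on B (\<lambda>b. b) \<and> (\<forall>x\<in>X. proj_on B (\<lambda>b. b) x = x)"
  using assms
proof (induction X)
  case empty
  show ?case by (rule exI[of _ "{}"]) (simp add: orthonormal_on_def)
next
  case (insert x X)
  then obtain B where B: "finite B" "orthonormal_on B (\<lambda>b. b)" "\<forall>x\<in>X. proj_on B (\<lambda>b. b) x = x"
    by blast
  show ?case
  proof (cases "proj_on B (\<lambda>b. b) x = x")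
    case True
    then show ?thesis using B by blast
  next
    case False
    from orthonormal_extend[OF B(1,2) False] obtain e
      where e: "orthonormal_on (insert e B) (\<lambda>b. b)" "proj_on (insert e B) (\<lambda>b. b) x = x" .
    have "proj_on (insert e B) (\<lambda>b. b) y = y" if "y \<in> X" for y
      by (rule proj_on_span_mono[where I = B and u = "\<lambda>b. b"])
        (use B e that in \<open>auto intro!: proj_on_member[where u = "\<lambda>b. b"]\<close>)
    then show ?thesis using B e by (intro exI[of _ "insert e B"]) auto
  qed
qed

text \<open>The unit sphere of a finite-dimensional subspace is a closed part of the continuous image of
  a product of discs.\<close>

lemma compact_orthonormal_sums:
  fixes u :: "'i \<Rightarrow> 'a :: complex_inner"
  assumes "finite I"
  shows "compact {\<Sum>i\<in>I. c i *\<^sub>C u i | c. \<forall>i\<in>I. norm (c i) \<le> 1}"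
  using assms
proof (induction I)
  case empty
  then show ?case by simp
next
  case (insert j I)
  let ?K = "{\<Sum>i\<in>I. c i *\<^sub>C u i | c. \<forall>i\<in>I. norm (c i) \<le> 1}"
  have "compact ((\<lambda>(a, x). a *\<^sub>C u j + x) ` (cball 0 1 \<times> ?K))"
    by (rule compact_continuous_image)
      (auto simp: case_prod_beta intro!: continuous_intros compact_Times insert.IH)
  also have "(\<lambda>(a, x). a *\<^sub>C u j + x) ` (cball 0 1 \<times> ?K)
      = {\<Sum>i\<in>insert j I. c i *\<^sub>C u i | c. \<forall>i\<in>insert j I. norm (c i) \<le> 1}"
  proof (intro equalityI subsetI)
    fix y assume "y \<in> (\<lambda>(a, x). a *\<^sub>C u j + x) ` (cball 0 1 \<times> ?K)"
    then obtain a c where ac: "norm a \<le> 1" "\<forall>i\<in>I. norm (c i) \<le> 1" "y = a *\<^sub>C u j + (\<Sum>i\<in>I. c i *\<^sub>C u i)"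
      by auto
    have "(\<Sum>i\<in>I. (c(j := a)) i *\<^sub>C u i) = (\<Sum>i\<in>I. c i *\<^sub>C u i)"
      by (rule sum.cong) (use insert.hyps in auto)
    then have "y = (\<Sum>i\<in>insert j I. (c(j := a)) i *\<^sub>C u i)"
      using ac insert.hyps by simp
    moreover have "\<forall>i\<in>insert j I. norm ((c(j := a)) i) \<le> 1" using ac by auto
    ultimately show "y \<in> {\<Sum>i\<in>insert j I. c i *\<^sub>C u i | c. \<forall>i\<in>insert j I. norm (c i) \<le> 1}"
      by blast
  next
    fix y assume "y \<in> {\<Sum>i\<in>insert j I. c i *\<^sub>C u i | c. \<forall>i\<in>insert j I. norm (c i) \<le> 1}"
    then obtain c where "y = c j *\<^sub>C u j + (\<Sum>i\<in>I. c i *\<^sub>C u i)" "\<forall>i\<in>insert j I. norm (c i) \<le> 1"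
      using insert.hyps by auto
    then show "y \<in> (\<lambda>(a, x). a *\<^sub>C u j + x) ` (cball 0 1 \<times> ?K)"
      by (intro image_eqI[where x = "(c j, \<Sum>i\<in>I. c i *\<^sub>C u i)"]) auto
  qed
  finally show ?case .
qed

lemma bounded_linear_proj_on: "bounded_linear (proj_on I u)"
  unfolding proj_on_def
  by (intro bounded_linear_sum bounded_linear_compose[OF bounded_bilinear.bounded_linear_left[OF bounded_bilinear_scaleC]]
      bounded_bilinear.bounded_linear_left[OF bounded_bilinear_cinner])

lemma continuous_on_proj_on [continuous_intros]:
  "continuous_on S f \<Longrightarrow> continuous_on S (\<lambda>x. proj_on I u (f x))"
  using bounded_linear.continuous_on[OF bounded_linear_proj_on] .

lemma compact_unit_sphere_span:
  assumes on: "orthonormal_on I u" and fin: "finite I"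
  shows "compact {x. proj_on I u x = x \<and> norm x = 1}"
proof -
  let ?K = "{\<Sum>i\<in>I. c i *\<^sub>C u i | c. \<forall>i\<in>I. norm (c i) \<le> 1}"
  have "{x. proj_on I u x = x \<and> norm x = 1} \<subseteq> ?K"
  proof safe
    fix x assume x: "proj_on I u x = x" "norm x = 1"
    have "norm (cinner x (u i)) \<le> 1" if "i \<in> I" for i
      using norm_cinner_le[of x "u i"] x orthonormal_on_norm[OF on that] by simp
    then show "\<exists>c. x = (\<Sum>i\<in>I. c i *\<^sub>C u i) \<and> (\<forall>i\<in>I. norm (c i) \<le> 1)"
      using x unfolding proj_on_def by (intro exI[of _ "\<lambda>i. cinner x (u i)"]) auto
  qed
  moreover have "closed {x. proj_on I u x = x \<and> norm x = 1}"
    by (intro closed_Collect_conj closed_Collect_eq continuous_intros)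
  ultimately have "compact (?K \<inter> {x. proj_on I u x = x \<and> norm x = 1})"
    by (intro compact_Int_closed compact_orthonormal_sums fin)
  with \<open>_ \<subseteq> ?K\<close> show ?thesis by (simp add: Int_absorb1)
qed

text \<open>Summing Bessel's inequality over the smaller family bounds the dimension.\<close>

lemma card_orthonormal_le:
  assumes I: "finite I" "orthonormal_on I u" and J: "finite J" "orthonormal_on J v"
    and span: "\<And>j. j \<in> J \<Longrightarrow> proj_on I u (v j) = v j"
  shows "card J \<le> card I"
proof -
  have "real (card J) = (\<Sum>j\<in>J. (norm (proj_on I u (v j)))\<^sup>2)"
    by (simp add: span orthonormal_on_norm[OF J(2)])
  also have "\<dots> = (\<Sum>j\<in>J. \<Sum>i\<in>I. (norm (cinner (v j) (u i)))\<^sup>2)"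
    by (simp add: norm_proj_on I)
  also have "\<dots> = (\<Sum>i\<in>I. \<Sum>j\<in>J. (norm (cinner (u i) (v j)))\<^sup>2)"
    by (subst sum.swap) (simp add: norm_cinner_commute)
  also have "\<dots> \<le> (\<Sum>i\<in>I. (norm (u i))\<^sup>2)"
    by (intro sum_mono bessel_inequality J)
  also have "\<dots> = real (card I)" by (simp add: orthonormal_on_norm[OF I(2)])
  finally show ?thesis by simp
qed

section \<open>Compressions of a positive operator to finite-dimensional subspaces\<close>

definition positive_op :: "('a :: complex_inner \<Rightarrow>\<^sub>L 'a) \<Rightarrow> bool"
  where "positive_op T \<longleftrightarrow> T \<in> bounded_ops \<and> (\<forall>x y. cinner (T x) y = cinner x (T y)) \<and>
    (\<forall>x. 0 \<le> Re (cinner (T x) x))"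

lemma bounded_ops_scaleC: "A \<in> bounded_ops \<Longrightarrow> A (c *\<^sub>C x) = c *\<^sub>C A x"
  by (simp add: bounded_ops_def)

lemma positive_op_bounded_ops: "positive_op T \<Longrightarrow> T \<in> bounded_ops"
  by (simp add: positive_op_def)

lemma positive_op_symmetric: "positive_op T \<Longrightarrow> cinner (T x) y = cinner x (T y)"
  by (simp add: positive_op_def)

lemma positive_op_nonneg: "positive_op T \<Longrightarrow> 0 \<le> Re (cinner (T x) x)"
  unfolding positive_op_def by blast

lemma positive_op_real: "positive_op T \<Longrightarrow> cinner (T x) x = of_real (Re (cinner (T x) x))"
  by (metis positive_op_symmetric cinner_commute complex_cnj_cancel_iff complex_is_Real_iff
      Reals_cnj_iff of_real_Re)

lemma linear_le_square_imp_zero: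
  fixes a b :: real
  assumes "\<And>t. a * t \<le> b * t\<^sup>2"
  shows "a = 0"
proof (rule ccontr)
  assume a: "a \<noteq> 0"
  define c where "c = \<bar>b\<bar> + 1"
  define t where "t = a / c"
  have c: "c > 0" "b < c" by (auto simp: c_def)
  then have "a * t = c * t\<^sup>2" by (simp add: t_def power2_eq_square)
  also have "\<dots> > b * t\<^sup>2"
    using a c by (intro mult_strict_right_mono) (auto simp: t_def)
  finally show False using assms[of t] by simp
qed

text \<open>Stationarity: at a maximum of the quadratic form on the unit sphere of a subspace \<open>W\<close>, the
  vector \<open>T w - \<langle>T w, w\<rangle> w\<close> is orthogonal to \<open>W\<close>, so \<open>w\<close> is an eigenvector of the compression.\<close>

lemma maximiser_is_eigenvector:
  fixes T :: "'a :: complex_inner \<Rightarrow>\<^sub>L 'a"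
  assumes T: "positive_op T"
    and W_add: "\<And>x y. x \<in> W \<Longrightarrow> y \<in> W \<Longrightarrow> x + y \<in> W"
    and W_scale: "\<And>c x. x \<in> W \<Longrightarrow> c *\<^sub>C x \<in> W"
    and w: "w \<in> W" "norm w = 1"
    and max: "\<And>x. x \<in> W \<Longrightarrow> norm x = 1 \<Longrightarrow> Re (cinner (T x) x) \<le> Re (cinner (T w) w)"
    and y: "y \<in> W" "cinner w y = 0"
  shows "cinner (T w) y = 0"
proof -
  define \<mu> where "\<mu> = Re (cinner (T w) w)"
  have bound: "Re (cinner (T x) x) \<le> \<mu> * (norm x)\<^sup>2" if "x \<in> W" for x
  proof (cases "x = 0")
    case False
    define z where "z = (1 / norm x) *\<^sub>R x"
    have x: "x = norm x *\<^sub>R z" using False by (simp add: z_def)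
    have "z \<in> W" using that W_scale by (simp add: z_def scaleR_scaleC)
    moreover have "norm z = 1" using False by (simp add: z_def)
    ultimately have "Re (cinner (T z) z) \<le> \<mu>" unfolding \<mu>_def by (rule max)
    then have "(norm x)\<^sup>2 * Re (cinner (T z) z) \<le> (norm x)\<^sup>2 * \<mu>" by (rule mult_left_mono) simp
    also have "(norm x)\<^sup>2 * Re (cinner (T z) z) = Re (cinner (T (norm x *\<^sub>R z)) (norm x *\<^sub>R z))"
      by (simp add: blinfun.scaleR_right cinner_scaleR_left cinner_scaleR_right power2_eq_square)
    also have "\<dots> = Re (cinner (T x) x)" by (simp flip: x)
    finally show ?thesis by (simp add: mult.commute)
  qed simp
  have Re0: "Re (cinner (T w) v) = 0" if v: "v \<in> W" "cinner w v = 0" for v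
  proof -
    have "2 * Re (cinner (T w) v) * t \<le> (\<mu> * (norm v)\<^sup>2 - Re (cinner (T v) v)) * t\<^sup>2" for t
    proof -
      have "w + t *\<^sub>R v \<in> W" using v w W_add W_scale by (simp add: scaleR_scaleC)
      then have "Re (cinner (T (w + t *\<^sub>R v)) (w + t *\<^sub>R v)) \<le> \<mu> * (norm (w + t *\<^sub>R v))\<^sup>2"
        by (rule bound)
      also have "(norm (w + t *\<^sub>R v))\<^sup>2 = 1 + t\<^sup>2 * (norm v)\<^sup>2"
        using pythagoras[of w "t *\<^sub>R v"] v w by (simp add: cinner_scaleR_right power_mult_distrib)
      also have "Re (cinner (T (w + t *\<^sub>R v)) (w + t *\<^sub>R v))
          = \<mu> + t * Re (cinner (T w) v) + t * Re (cinner (T v) w) + t\<^sup>2 * Re (cinner (T v) v)"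
        by (simp add: \<mu>_def blinfun.add_right blinfun.scaleR_right cinner_add_left cinner_add_right
            cinner_scaleR_left cinner_scaleR_right power2_eq_square algebra_simps)
      also have "Re (cinner (T v) w) = Re (cinner (T w) v)"
        using positive_op_symmetric[OF T, of v w] cinner_commute[of v "T w"] by simp
      finally show ?thesis by (simp add: algebra_simps)
    qed
    from linear_le_square_imp_zero[OF this] show ?thesis by simp
  qed
  have "Re (cinner (T w) (\<i> *\<^sub>C y)) = 0"
    by (rule Re0) (simp_all add: W_scale y cinner_scaleC_right)
  then show ?thesis using Re0[OF y] by (simp add: complex_eq_iff cinner_scaleC_right)
qed

text \<open>The spectral theorem for the compression of \<open>T\<close> to the span of \<open>B\<close>: among orthonormal sets
  of eigenvectors of the compression, one of maximal cardinality spans, since otherwise a maximiser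
  of the quadratic form on its orthogonal complement could be added.\<close>

lemma compression_diagonalisation:
  fixes T :: "'a :: complex_inner \<Rightarrow>\<^sub>L 'a"
  assumes T: "positive_op T" and B: "finite B" "orthonormal_on B (\<lambda>b. b)"
  shows "\<exists>D. finite D \<and> orthonormal_on D (\<lambda>d. d) \<and>
    (\<forall>d\<in>D. proj_on B (\<lambda>b. b) d = d) \<and> (\<forall>b\<in>B. proj_on D (\<lambda>d. d) b = b) \<and>
    (\<forall>d\<in>D. \<forall>d'\<in>D. d \<noteq> d' \<longrightarrow> cinner (T d) d' = 0)"
proof -
  define V where "V = {x. proj_on B (\<lambda>b. b) x = x}"
  have V_add: "x + y \<in> V" if "x \<in> V" "y \<in> V" for x y using that by (simp add: V_def proj_on_add)
  have V_scale: "c *\<^sub>C x \<in> V" if "x \<in> V" for c x using that by (simp add: V_def proj_on_scaleC)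
  have V_diff: "x - y \<in> V" if "x \<in> V" "y \<in> V" for x y using that by (simp add: V_def proj_on_diff)
  have V_sum: "sum f I \<in> V" if "\<And>i. i \<in> I \<Longrightarrow> f i \<in> V" for f I
    using that by (simp add: V_def proj_on_sum)
  define good where "good D \<longleftrightarrow> finite D \<and> orthonormal_on D (\<lambda>d. d) \<and> D \<subseteq> V \<and>
    (\<forall>d\<in>D. \<forall>y\<in>V. cinner d y = 0 \<longrightarrow> cinner (T d) y = 0)" for D
  have "good {}" by (simp add: good_def orthonormal_on_def)
  moreover have "\<forall>D. good D \<longrightarrow> card D < Suc (card B)"
    using card_orthonormal_le[OF B, where v = "\<lambda>d. d"]
    by (auto simp: good_def V_def less_Suc_eq_le subset_eq)
  ultimately obtain D where D: "good D" and D_max: "\<And>D'. good D' \<Longrightarrow> card D' \<le> card D"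
    using ex_has_greatest_nat[of good "{}" card "Suc (card B)"] by blast
  have fin: "finite D" and on: "orthonormal_on D (\<lambda>d. d)" and DV: "\<And>d. d \<in> D \<Longrightarrow> d \<in> V"
    and DT: "\<And>d y. d \<in> D \<Longrightarrow> y \<in> V \<Longrightarrow> cinner d y = 0 \<Longrightarrow> cinner (T d) y = 0"
    using D by (auto simp: good_def)
  have proj_V: "proj_on D (\<lambda>d. d) x \<in> V" for x
    unfolding proj_on_def by (intro V_sum V_scale DV)
  have complete: "proj_on D (\<lambda>d. d) b = b" if "b \<in> V" for b
  proof (rule ccontr)
    assume neq: "proj_on D (\<lambda>d. d) b \<noteq> b"
    define W where "W = {x \<in> V. \<forall>d\<in>D. cinner x d = 0}"
    define S where "S = W \<inter> {x. norm x = 1}"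
    have W_add: "x + y \<in> W" if "x \<in> W" "y \<in> W" for x y
      using that by (simp add: W_def V_add cinner_add_left)
    have W_scale: "c *\<^sub>C x \<in> W" if "x \<in> W" for c x
      using that by (simp add: W_def V_scale cinner_scaleC_left)
    define r where "r = b - proj_on D (\<lambda>d. d) b"
    have "r \<in> W"
      unfolding W_def r_def using that on fin
      by (auto intro!: V_diff proj_V cinner_residual_orthonormal[where u = "\<lambda>d. d"])
    then have "(1 / norm r) *\<^sub>R r \<in> W" unfolding scaleR_scaleC by (rule W_scale)
    moreover have "norm ((1 / norm r) *\<^sub>R r) = 1" using neq by (simp add: r_def)
    ultimately have "(1 / norm r) *\<^sub>R r \<in> S" by (simp add: S_def)
    then have ne: "S \<noteq> {}" by blast
    have "S = {x. proj_on B (\<lambda>b. b) x = x \<and> norm x = 1} \<inter> (\<Inter>d\<in>D. {x. cinner x d = 0})"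
      by (auto simp: S_def W_def V_def)
    moreover have "closed (\<Inter>d\<in>D. {x. cinner x d = 0})"
      by (intro closed_INT ballI closed_Collect_eq continuous_intros)
    ultimately have comp: "compact S"
      using compact_Int_closed[OF compact_unit_sphere_span[OF B(2,1)]] by simp
    have "continuous_on S (\<lambda>x. Re (cinner (T x) x))" by (intro continuous_intros)
    from continuous_attains_sup[OF comp ne this] obtain w
      where w: "w \<in> S" and max: "\<And>x. x \<in> S \<Longrightarrow> Re (cinner (T x) x) \<le> Re (cinner (T w) w)" by blast
    have wW: "w \<in> W" and w1: "norm w = 1" using w by (auto simp: S_def)
    have wV: "w \<in> V" and wD: "\<And>d. d \<in> D \<Longrightarrow> cinner w d = 0" using wW by (auto simp: W_def)
    have Tw: "cinner (T w) y = 0" if y: "y \<in> V" "cinner w y = 0" for y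
    proof -
      let ?p = "proj_on D (\<lambda>d. d) y"
      have "cinner w ?p = 0"
        by (simp add: proj_on_def cinner_sum_right cinner_scaleC_right wD)
      then have "cinner w (y - ?p) = 0" using y by (simp add: cinner_diff_right)
      moreover have "y - ?p \<in> W"
        unfolding W_def using y on fin
        by (auto intro!: V_diff proj_V cinner_residual_orthonormal[where u = "\<lambda>d. d"])
      ultimately have 1: "cinner (T w) (y - ?p) = 0"
        using maximiser_is_eigenvector[OF T W_add W_scale wW w1] max by (auto simp: S_def)
      have "cinner (T w) d = 0" if "d \<in> D" for d
      proof -
        have "cinner d w = 0" using wD[OF that] cinner_eq_0_sym by blast
        from DT[OF that wV this] have "cinner w (T d) = 0" using cinner_eq_0_sym by blast
        then show ?thesis by (simp add: positive_op_symmetric[OF T])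
      qed
      then have "cinner (T w) ?p = 0"
        by (simp add: proj_on_def cinner_sum_right cinner_scaleC_right)
      with 1 show ?thesis by (simp add: cinner_diff_right)
    qed
    have "good (insert w D)"
      unfolding good_def using fin orthonormal_on_insert[OF on w1 wD] wV DV DT Tw by auto
    then have "card (insert w D) \<le> card D" by (rule D_max)
    moreover have "w \<notin> D" using wD[of w] w1 by (auto simp: cinner_self)
    ultimately show False using fin by simp
  qed
  show ?thesis
  proof (intro exI[of _ D] conjI ballI impI)
    show "proj_on D (\<lambda>d. d) b = b" if "b \<in> B" for b
      using proj_on_member[OF B(2,1) that] by (intro complete) (simp add: V_def)
    show "cinner (T d) d' = 0" if "d \<in> D" "d' \<in> D" "d \<noteq> d'" for d d'
      using that orthonormal_on_cinner[OF on] by (intro DT DV) auto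
  qed (use fin on DV in \<open>auto simp: V_def\<close>)
qed

text \<open>On the span of \<open>D\<close> the compression of \<open>T\<close> is diagonal, so \<open>d\<close> picks out its own eigenvalue.\<close>

lemma eigenvector_of_compression:
  fixes T :: "'a :: complex_inner \<Rightarrow>\<^sub>L 'a"
  assumes T: "positive_op T" and D: "finite D" "orthonormal_on D (\<lambda>d. d)"
    and diag: "\<And>d d'. d \<in> D \<Longrightarrow> d' \<in> D \<Longrightarrow> d \<noteq> d' \<Longrightarrow> cinner (T d) d' = 0"
    and y: "proj_on D (\<lambda>d. d) y = y" and d: "d \<in> D"
  shows "cinner (T y) d = complex_of_real (Re (cinner (T d) d)) * cinner y d"
proof -
  have "cinner (T y) d = cinner (proj_on D (\<lambda>d. d) y) (T d)"
    by (simp add: y positive_op_symmetric[OF T])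
  also have "\<dots> = (\<Sum>d'\<in>D. cinner y d' * cinner d' (T d))"
    by (simp add: proj_on_def cinner_sum_left cinner_scaleC_left)
  also have "\<dots> = (\<Sum>d'\<in>D. if d' = d then cinner y d * cinner (T d) d else 0)"
  proof (rule sum.cong[OF refl])
    fix d' assume "d' \<in> D"
    then show "cinner y d' * cinner d' (T d) = (if d' = d then cinner y d * cinner (T d) d else 0)"
      using diag[of d d'] d cinner_eq_0_sym[of d' "T d"] positive_op_symmetric[OF T, of d d] by auto
  qed
  finally show ?thesis using D d positive_op_real[OF T, of d] by simp
qed

lemma funpow_comp_blinfun: "(((o\<^sub>L) T ^^ i) id_blinfun) x = (blinfun_apply T ^^ i) x"
  for T :: "'a :: real_normed_vector \<Rightarrow>\<^sub>L 'a"
  by (induction i) simp_all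

lemma op_poly_apply: "op_poly q T x = (\<Sum>i\<le>degree q. coeff q i *\<^sub>R (blinfun_apply T ^^ i) x)"
  by (simp add: op_poly_def blinfun.sum_left blinfun.scaleR_left funpow_comp_blinfun)

text \<open>A Gauss quadrature rule for \<open>T\<close>: compressing \<open>T\<close> to the span of the Krylov vectors
  \<open>T\<^sup>i x\<close>, \<open>i \<le> n\<close>, \<open>x \<in> X\<close>, does not change \<open>q(T) x\<close> for polynomials \<open>q\<close> of degree at most \<open>n\<close>.\<close>

lemma krylov_quadrature:
  fixes T :: "'a :: complex_inner \<Rightarrow>\<^sub>L 'a"
  assumes T: "positive_op T" and X: "finite X"
  obtains D where "finite D" "orthonormal_on D (\<lambda>d. d)"
    and "\<And>d d'. d \<in> D \<Longrightarrow> d' \<in> D \<Longrightarrow> d \<noteq> d' \<Longrightarrow> cinner (T d) d' = 0"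
    and "\<And>d. d \<in> D \<Longrightarrow> Re (cinner (T d) d) \<in> {0..norm T}"
    and "\<And>x q. x \<in> X \<Longrightarrow> degree q \<le> n \<Longrightarrow>
      op_poly q T x = (\<Sum>d\<in>D. (complex_of_real (poly q (Re (cinner (T d) d))) * cinner x d) *\<^sub>C d)"
proof -
  let ?X = "\<Union>i\<le>n. (blinfun_apply T ^^ i) ` X"
  have "finite ?X" using X by simp
  from gram_schmidt[OF this] obtain B
    where B: "finite B" "orthonormal_on B (\<lambda>b. b)" "\<forall>x\<in>?X. proj_on B (\<lambda>b. b) x = x"
    by (elim exE conjE) (rule that)
  from compression_diagonalisation[OF T B(1,2)] obtain D
    where D: "finite D" "orthonormal_on D (\<lambda>d. d)" and "\<forall>d\<in>D. proj_on B (\<lambda>b. b) d = d"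
      and BD: "\<forall>b\<in>B. proj_on D (\<lambda>d. d) b = b"
      and diag': "\<forall>d\<in>D. \<forall>d'\<in>D. d \<noteq> d' \<longrightarrow> cinner (T d) d' = 0"
    by (elim exE conjE) (rule that)
  note diag = diag'[rule_format]
  have XD: "proj_on D (\<lambda>d. d) ((blinfun_apply T ^^ i) x) = (blinfun_apply T ^^ i) x"
    if "x \<in> X" "i \<le> n" for x i
    by (rule proj_on_span_mono[where I = B and u = "\<lambda>b. b"]) (use that B D BD in auto)
  have pow: "cinner ((blinfun_apply T ^^ i) x) d = complex_of_real (Re (cinner (T d) d) ^ i) * cinner x d"
    if "x \<in> X" "d \<in> D" "i \<le> n" for x d i
    using that(3)
  proof (induction i)
    case (Suc i)
    have "proj_on D (\<lambda>d. d) ((blinfun_apply T ^^ i) x) = (blinfun_apply T ^^ i) x"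
      using Suc.prems that by (intro XD) auto
    from eigenvector_of_compression[OF T D diag this that(2)] show ?case
      using Suc by simp
  qed simp
  have eig: "Re (cinner (T d) d) \<in> {0..norm T}" if "d \<in> D" for d
  proof -
    have "Re (cinner (T d) d) \<le> norm (cinner (T d) d)" by (rule complex_Re_le_cmod)
    also have "\<dots> \<le> norm (T d) * norm d" by (rule norm_cinner_le)
    also have "\<dots> \<le> norm T"
      using norm_blinfun[of T d] orthonormal_on_norm[OF D(2) that] by simp
    finally show ?thesis by (simp add: positive_op_nonneg[OF T])
  qed
  have "op_poly q T x = (\<Sum>d\<in>D. (complex_of_real (poly q (Re (cinner (T d) d))) * cinner x d) *\<^sub>C d)"
    if "x \<in> X" "degree q \<le> n" for x q
  proof -
    have "proj_on D (\<lambda>d. d) (op_poly q T x) = op_poly q T x"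
      unfolding op_poly_apply proj_on_sum scaleR_scaleC proj_on_scaleC
      by (rule sum.cong[OF refl]) (use that in \<open>auto simp: XD\<close>)
    moreover have "cinner (op_poly q T x) d = complex_of_real (poly q (Re (cinner (T d) d))) * cinner x d" if "d \<in> D" for d
    proof -
      have "cinner (op_poly q T x) d
          = (\<Sum>i\<le>degree q. of_real (coeff q i) * (complex_of_real (Re (cinner (T d) d) ^ i) * cinner x d))"
        unfolding op_poly_apply cinner_sum_left cinner_scaleR_left
        by (rule sum.cong[OF refl]) (use \<open>x \<in> X\<close> \<open>degree q \<le> n\<close> that in \<open>auto simp: pow\<close>)
      then show ?thesis by (simp add: poly_altdef sum_distrib_right mult.assoc)
    qed
    ultimately show ?thesis unfolding proj_on_def by simp
  qed
  then show thesis using that[OF D diag eig] by blast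
qed

section \<open>Continuous functional calculus of a positive operator\<close>

lemma op_poly_apply_upto:
  assumes "degree q \<le> n"
  shows "op_poly q T x = (\<Sum>i\<le>n. coeff q i *\<^sub>R (blinfun_apply T ^^ i) x)"
  unfolding op_poly_apply
  by (rule sum.mono_neutral_left) (use assms in \<open>auto simp: coeff_eq_0\<close>)

lemma op_poly_diff: "op_poly (p - q) T = op_poly p T - op_poly q T"
proof (rule blinfun_eqI)
  fix x
  let ?n = "max (degree p) (degree q)"
  show "op_poly (p - q) T x = (op_poly p T - op_poly q T) x"
    unfolding blinfun.diff_left
    by (subst (1 2 3) op_poly_apply_upto[where n = ?n])
      (auto simp: degree_diff_le scaleR_left_diff_distrib sum_subtractf)
qed

lemma op_poly_bounded_ops:
  assumes "T \<in> bounded_ops"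
  shows "op_poly q T \<in> bounded_ops"
proof -
  have pow: "(blinfun_apply T ^^ i) (c *\<^sub>C x) = c *\<^sub>C (blinfun_apply T ^^ i) x" for i c x
    by (induction i) (simp_all add: bounded_ops_scaleC[OF assms])
  have "op_poly q T (c *\<^sub>C x) = c *\<^sub>C op_poly q T x" for c x
    unfolding op_poly_apply
    by (simp add: pow scaleC_sum_right scaleR_scaleC scaleC_scaleC mult.commute)
  then show ?thesis by (simp add: bounded_ops_def)
qed

lemma op_poly_symmetric:
  assumes "positive_op T"
  shows "cinner (op_poly q T x) y = cinner x (op_poly q T y)"
proof -
  have pow: "cinner ((blinfun_apply T ^^ i) x) y = cinner x ((blinfun_apply T ^^ i) y)" for i y
    by (induction i arbitrary: y)
      (simp_all add: positive_op_symmetric[OF assms], simp add: funpow_swap1)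
  show ?thesis
    by (simp add: op_poly_apply cinner_sum_left cinner_sum_right cinner_scaleR_left
        cinner_scaleR_right pow)
qed

lemma krylov_quadrature_single:
  fixes T :: "'a :: complex_inner \<Rightarrow>\<^sub>L 'a"
  assumes "positive_op T"
  obtains D where "finite D" "orthonormal_on D (\<lambda>d. d)"
    and "\<And>d. d \<in> D \<Longrightarrow> Re (cinner (T d) d) \<in> {0..norm T}"
    and "op_poly q T x = (\<Sum>d\<in>D. (complex_of_real (poly q (Re (cinner (T d) d))) * cinner x d) *\<^sub>C d)"
proof (rule krylov_quadrature[OF assms, where X = "{x}" and n = "degree q"])
  fix D assume "finite D" "orthonormal_on D (\<lambda>d. d)"
    and "\<And>d. d \<in> D \<Longrightarrow> Re (cinner (T d) d) \<in> {0..norm T}"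
    and "\<And>y p. y \<in> {x} \<Longrightarrow> degree p \<le> degree q \<Longrightarrow>
      op_poly p T y = (\<Sum>d\<in>D. (complex_of_real (poly p (Re (cinner (T d) d))) * cinner y d) *\<^sub>C d)"
  then show thesis by (intro that[of D]) simp_all
qed simp

text \<open>By the quadrature rule \<open>q(T) x\<close> has the coefficients of \<open>x\<close>, multiplied by values of \<open>q\<close> on
  \<open>[0, \<parallel>T\<parallel>]\<close>.\<close>

lemma norm_op_poly_le:
  fixes T :: "'a :: complex_inner \<Rightarrow>\<^sub>L 'a"
  assumes T: "positive_op T" and q: "\<And>t. t \<in> {0..norm T} \<Longrightarrow> \<bar>poly q t\<bar> \<le> c"
  shows "norm (op_poly q T) \<le> c"
proof (rule norm_blinfun_bound)
  show c: "0 \<le> c" using q[of 0] by simp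
  fix x
  obtain D where D: "finite D" "orthonormal_on D (\<lambda>d. d)"
    and eig: "\<And>d. d \<in> D \<Longrightarrow> Re (cinner (T d) d) \<in> {0..norm T}"
    and quad: "op_poly q T x = (\<Sum>d\<in>D. (complex_of_real (poly q (Re (cinner (T d) d))) * cinner x d) *\<^sub>C d)"
    by (rule krylov_quadrature_single[OF T, where q = q and x = x]) (rule that)
  have "(norm (op_poly q T x))\<^sup>2 = (\<Sum>d\<in>D. (\<bar>poly q (Re (cinner (T d) d))\<bar> * norm (cinner x d))\<^sup>2)"
    by (simp add: quad norm_orthonormal_sum[OF D(2,1)] norm_mult)
  also have "\<dots> \<le> (\<Sum>d\<in>D. (c * norm (cinner x d))\<^sup>2)"
    by (intro sum_mono power_mono mult_right_mono q eig) auto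
  also have "\<dots> = c\<^sup>2 * (\<Sum>d\<in>D. (norm (cinner x d))\<^sup>2)"
    by (simp add: power_mult_distrib sum_distrib_left)
  also have "\<dots> \<le> c\<^sup>2 * (norm x)\<^sup>2"
    by (intro mult_left_mono bessel_inequality[OF D(2,1)]) simp
  finally show "norm (op_poly q T x) \<le> c * norm x"
    using c by (simp add: power_mult_distrib[symmetric] power2_le_iff_abs_le)
qed

lemma weierstrass_poly:
  fixes f :: "real \<Rightarrow> real"
  assumes "continuous_on {a..b} f" "0 < e"
  obtains q :: "real poly" where "\<And>t. t \<in> {a..b} \<Longrightarrow> \<bar>poly q t - f t\<bar> \<le> e"
proof -
  obtain g where g: "real_polynomial_function g" "\<And>t. t \<in> {a..b} \<Longrightarrow> \<bar>f t - g t\<bar> < e"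
    using Stone_Weierstrass_real_polynomial_function[OF compact_Icc assms] by blast
  then obtain c n where c: "g = (\<lambda>x. \<Sum>i\<le>n. c i * x ^ i)"
    using real_polynomial_function_iff_sum by blast
  have "poly (\<Sum>i\<le>n. monom (c i) i) t = g t" for t
    by (simp add: poly_sum poly_monom c)
  with g that[of "\<Sum>i\<le>n. monom (c i) i"] show thesis
    by (metis abs_minus_commute less_imp_le)
qed

lemma weierstrass_sequence:
  fixes f :: "real \<Rightarrow> real"
  assumes f: "continuous_on {a..b} f"
  obtains p :: "nat \<Rightarrow> real poly" where "\<And>n t. t \<in> {a..b} \<Longrightarrow> \<bar>poly (p n) t - f t\<bar> \<le> 1 / Suc n"
    and "uniform_limit {a..b} (\<lambda>n. poly (p n)) f sequentially"
proof -
  have "\<exists>p. \<forall>t\<in>{a..b}. \<bar>poly p t - f t\<bar> \<le> 1 / Suc n" for n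
    by (rule weierstrass_poly[OF f, of "1 / Suc n"]) (simp, blast)
  then obtain p where p: "\<And>n t. t \<in> {a..b} \<Longrightarrow> \<bar>poly (p n) t - f t\<bar> \<le> 1 / Suc n" by metis
  have "uniform_limit {a..b} (\<lambda>n. poly (p n)) f sequentially"
  proof (rule uniform_limitI)
    fix e :: real assume "e > 0"
    then have "eventually (\<lambda>n. 1 / real (Suc n) < e) sequentially"
      using order_tendstoD(2)[OF LIMSEQ_inverse_real_of_nat] by (simp add: inverse_eq_divide)
    then show "\<forall>\<^sub>F n in sequentially. \<forall>t\<in>{a..b}. dist (poly (p n) t) (f t) < e"
    proof eventually_elim
      case (elim n)
      show ?case
      proof
        fix t assume "t \<in> {a..b}"
        from p[OF this, of n] elim show "dist (poly (p n) t) (f t) < e" by (simp add: dist_real_def)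
      qed
    qed
  qed
  with p that show thesis by blast
qed

text \<open>By the norm bound, polynomials that are uniformly close give operators that are close, so
  polynomial approximations of \<open>f\<close> yield Cauchy sequences with a common limit.\<close>

lemma fun_calc_limit:
  fixes T :: "'a :: complex_hilbert \<Rightarrow>\<^sub>L 'a"
  assumes T: "positive_op T" and f: "continuous_on {0..norm T} f"
    and q: "uniform_limit {0..norm T} (\<lambda>n. poly (q n)) f sequentially"
  shows "(\<lambda>n. op_poly (q n) T) \<longlonglongrightarrow> fun_calc f T"
proof -
  have dist: "eventually (\<lambda>n. norm (op_poly (r n) T - op_poly (s n) T) \<le> e) sequentially"
    if r: "uniform_limit {0..norm T} (\<lambda>n. poly (r n)) f sequentially"
      and s: "uniform_limit {0..norm T} (\<lambda>n. poly (s n)) f sequentially" and e: "e > 0" for r s e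
  proof -
    have "e / 2 > 0" using e by simp
    from uniform_limitD[OF r this] uniform_limitD[OF s this] show ?thesis
    proof eventually_elim
      case (elim n)
      show ?case unfolding op_poly_diff[symmetric]
      proof (rule norm_op_poly_le[OF T])
        fix t assume "t \<in> {0..norm T}"
        then have "\<bar>poly (r n) t - f t\<bar> < e / 2" "\<bar>poly (s n) t - f t\<bar> < e / 2"
          using elim by (auto simp: dist_real_def)
        then show "\<bar>poly (r n - s n) t\<bar> \<le> e" unfolding poly_diff by linarith
      qed
    qed
  qed
  from weierstrass_sequence[OF f] obtain p
    where p: "\<And>n t. t \<in> {0..norm T} \<Longrightarrow> \<bar>poly (p n) t - f t\<bar> \<le> 1 / Suc n"
      and p_lim: "uniform_limit {0..norm T} (\<lambda>n. poly (p n)) f sequentially" by blast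
  have "Cauchy (\<lambda>n. op_poly (p n) T)"
  proof (rule metric_CauchyI)
    fix e :: real assume e: "e > 0"
    then obtain N where N: "1 / real (Suc N) < e / 2"
      using reals_Archimedean[of "e / 2"] by (auto simp: inverse_eq_divide)
    have "dist (op_poly (p m) T) (op_poly (p n) T) < e" if "m \<ge> N" "n \<ge> N" for m n
    proof -
      have le: "1 / real (Suc m) \<le> 1 / real (Suc N)" "1 / real (Suc n) \<le> 1 / real (Suc N)"
        using that by (simp_all add: frac_le)
      have "norm (op_poly (p m - p n) T) \<le> 2 * (1 / real (Suc N))"
      proof (rule norm_op_poly_le[OF T])
        fix t assume "t \<in> {0..norm T}"
        from p[OF this, of m] p[OF this, of n] le
        show "\<bar>poly (p m - p n) t\<bar> \<le> 2 * (1 / real (Suc N))" by simp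
      qed
      then show ?thesis using N by (simp add: dist_norm op_poly_diff)
    qed
    then show "\<exists>M. \<forall>m\<ge>M. \<forall>n\<ge>M. dist (op_poly (p m) T) (op_poly (p n) T) < e" by blast
  qed
  then obtain S where S: "(\<lambda>n. op_poly (p n) T) \<longlonglongrightarrow> S"
    using Cauchy_convergent convergent_def by blast
  have lim: "(\<lambda>n. op_poly (r n) T) \<longlonglongrightarrow> S"
    if r: "uniform_limit {0..norm T} (\<lambda>n. poly (r n)) f sequentially" for r
  proof -
    have "(\<lambda>n. op_poly (r n) T - op_poly (p n) T) \<longlonglongrightarrow> 0"
    proof (rule tendstoI)
      fix e :: real assume "e > 0"
      then have "e / 2 > 0" by simp
      from dist[OF r p_lim this] show "\<forall>\<^sub>F n in sequentially.
          dist (op_poly (r n) T - op_poly (p n) T) 0 < e"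
        by eventually_elim (use \<open>e > 0\<close> in simp)
    qed
    from tendsto_add[OF this S] show ?thesis by simp
  qed
  have "fun_calc f T = S"
    unfolding fun_calc_def
  proof (rule the_equality)
    fix S' assume "\<forall>q. uniform_limit {0..norm T} (\<lambda>n. poly (q n)) f sequentially \<longrightarrow>
      (\<lambda>n. op_poly (q n) T) \<longlonglongrightarrow> S'"
    then show "S' = S" using LIMSEQ_unique[OF _ S] p_lim by blast
  qed (use lim in blast)
  then show ?thesis using lim[OF q] by simp
qed

lemma fun_calc_approx:
  fixes T :: "'a :: complex_hilbert \<Rightarrow>\<^sub>L 'a"
  assumes T: "positive_op T" and f: "continuous_on {0..norm T} f"
    and q: "\<And>t. t \<in> {0..norm T} \<Longrightarrow> \<bar>poly q t - f t\<bar> \<le> e"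
  shows "norm (op_poly q T - fun_calc f T) \<le> e"
proof -
  from weierstrass_sequence[OF f] obtain p
    where p: "\<And>n t. t \<in> {0..norm T} \<Longrightarrow> \<bar>poly (p n) t - f t\<bar> \<le> 1 / Suc n"
      and p_lim: "uniform_limit {0..norm T} (\<lambda>n. poly (p n)) f sequentially" by blast
  have "(\<lambda>n. norm (op_poly q T - op_poly (p n) T)) \<longlonglongrightarrow> norm (op_poly q T - fun_calc f T)"
    by (intro tendsto_intros fun_calc_limit T f p_lim)
  moreover have "(\<lambda>n. e + 1 / real (Suc n)) \<longlonglongrightarrow> e + 0"
    using LIMSEQ_inverse_real_of_nat by (intro tendsto_intros) (simp add: inverse_eq_divide)
  moreover have "norm (op_poly q T - op_poly (p n) T) \<le> e + 1 / real (Suc n)" for n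
    unfolding op_poly_diff[symmetric]
  proof (rule norm_op_poly_le[OF T])
    fix t assume "t \<in> {0..norm T}"
    from p[OF this, of n] q[OF this] show "\<bar>poly (q - p n) t\<bar> \<le> e + 1 / real (Suc n)" by simp
  qed
  ultimately show ?thesis using LIMSEQ_le[where X = "\<lambda>n. norm (op_poly q T - op_poly (p n) T)"] by fastforce
qed

lemma fun_calc_quadratic_form:
  fixes T :: "'a :: complex_hilbert \<Rightarrow>\<^sub>L 'a"
  assumes "positive_op T" "continuous_on {0..norm T} f"
    and "\<And>t. t \<in> {0..norm T} \<Longrightarrow> \<bar>poly q t - f t\<bar> \<le> e"
  shows "\<bar>Re (cinner (op_poly q T x) x) - Re (cinner (fun_calc f T x) x)\<bar> \<le> e * (norm x)\<^sup>2"
proof -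
  let ?A = "op_poly q T - fun_calc f T"
  have "\<bar>Re (cinner (op_poly q T x) x) - Re (cinner (fun_calc f T x) x)\<bar> = \<bar>Re (cinner (?A x) x)\<bar>"
    by (simp add: blinfun.diff_left cinner_diff_left)
  also have "\<dots> \<le> norm (cinner (?A x) x)" by (rule abs_Re_le_cmod)
  also have "\<dots> \<le> norm (?A x) * norm x" by (rule norm_cinner_le)
  also have "\<dots> \<le> (norm ?A * norm x) * norm x" by (intro mult_right_mono norm_blinfun) simp
  also have "\<dots> \<le> (e * norm x) * norm x"
    by (intro mult_right_mono fun_calc_approx assms) simp_all
  finally show ?thesis by (simp add: power2_eq_square mult.assoc)
qed

lemma quadrature_quadratic_form:
  "Re (cinner (\<Sum>d\<in>D. (complex_of_real (a d) * cinner x d) *\<^sub>C d) x)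
    = (\<Sum>d\<in>D. a d * (norm (cinner x d))\<^sup>2)"
proof -
  have "cinner (\<Sum>d\<in>D. (complex_of_real (a d) * cinner x d) *\<^sub>C d) x
      = complex_of_real (\<Sum>d\<in>D. a d * (norm (cinner x d))\<^sup>2)"
    unfolding of_real_sum of_real_mult complex_norm_square cinner_sum_left cinner_scaleC_left
    by (rule sum.cong) (simp_all add: mult.assoc flip: cinner_commute)
  then show ?thesis by simp
qed

text \<open>Each property passes to the limit along polynomials; for positivity these are bounded below
  by \<open>- 1 / (n + 1)\<close> on \<open>[0, \<parallel>T\<parallel>]\<close>, and so are their quadratic forms on unit vectors.\<close>

lemma fun_calc_positive:
  fixes T :: "'a :: complex_hilbert \<Rightarrow>\<^sub>L 'a"
  assumes T: "positive_op T" and f: "continuous_on {0..norm T} f"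
    and nonneg: "\<And>t. t \<in> {0..norm T} \<Longrightarrow> 0 \<le> f t"
  shows "positive_op (fun_calc f T)"
proof -
  from weierstrass_sequence[OF f] obtain p
    where p: "\<And>n t. t \<in> {0..norm T} \<Longrightarrow> \<bar>poly (p n) t - f t\<bar> \<le> 1 / Suc n" by blast
  have null: "(\<lambda>n. 1 / real (Suc n)) \<longlonglongrightarrow> 0"
    using LIMSEQ_inverse_real_of_nat by (simp add: inverse_eq_divide)
  have "(\<lambda>n. op_poly (p n) T - fun_calc f T) \<longlonglongrightarrow> 0"
    by (rule Lim_null_comparison[OF _ null]) (use fun_calc_approx[OF T f p] in simp)
  then have lim: "(\<lambda>n. op_poly (p n) T) \<longlonglongrightarrow> fun_calc f T" by (rule LIM_zero_cancel)
  have lim_x: "(\<lambda>n. op_poly (p n) T x) \<longlonglongrightarrow> fun_calc f T x" for x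
    using lim by (intro tendsto_intros)
  have "fun_calc f T (c *\<^sub>C x) = c *\<^sub>C fun_calc f T x" for c x
  proof (rule LIMSEQ_unique[OF lim_x])
    have "(\<lambda>n. c *\<^sub>C op_poly (p n) T x) \<longlonglongrightarrow> c *\<^sub>C fun_calc f T x"
      by (intro bounded_bilinear.tendsto[OF bounded_bilinear_scaleC] tendsto_const lim_x)
    then show "(\<lambda>n. op_poly (p n) T (c *\<^sub>C x)) \<longlonglongrightarrow> c *\<^sub>C fun_calc f T x"
      by (simp add: bounded_ops_scaleC[OF op_poly_bounded_ops] positive_op_bounded_ops[OF T])
  qed
  moreover have "cinner (fun_calc f T x) y = cinner x (fun_calc f T y)" for x y
  proof (rule LIMSEQ_unique)
    show "(\<lambda>n. cinner (op_poly (p n) T x) y) \<longlonglongrightarrow> cinner (fun_calc f T x) y"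
      by (intro tendsto_intros lim_x)
    show "(\<lambda>n. cinner (op_poly (p n) T x) y) \<longlonglongrightarrow> cinner x (fun_calc f T y)"
      unfolding op_poly_symmetric[OF T] by (intro tendsto_intros lim_x)
  qed
  moreover have "0 \<le> Re (cinner (fun_calc f T x) x)" for x
  proof -
    have "- (1 / real (Suc n)) * (norm x)\<^sup>2 \<le> Re (cinner (op_poly (p n) T x) x)" for n
    proof -
      obtain D where D: "finite D" "orthonormal_on D (\<lambda>d. d)"
        and eig: "\<And>d. d \<in> D \<Longrightarrow> Re (cinner (T d) d) \<in> {0..norm T}"
        and quad: "op_poly (p n) T x
          = (\<Sum>d\<in>D. (complex_of_real (poly (p n) (Re (cinner (T d) d))) * cinner x d) *\<^sub>C d)"
        by (rule krylov_quadrature_single[OF T, where q = "p n" and x = x]) (rule that)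
      have "- (1 / real (Suc n)) * (norm x)\<^sup>2 \<le> - (1 / real (Suc n)) * (\<Sum>d\<in>D. (norm (cinner x d))\<^sup>2)"
        by (intro mult_left_mono_neg bessel_inequality D) simp
      also have "\<dots> = (\<Sum>d\<in>D. - (1 / real (Suc n)) * (norm (cinner x d))\<^sup>2)"
        by (simp only: sum_distrib_left)
      also have "\<dots> \<le> (\<Sum>d\<in>D. poly (p n) (Re (cinner (T d) d)) * (norm (cinner x d))\<^sup>2)"
      proof (intro sum_mono mult_right_mono)
        fix d assume "d \<in> D"
        from p[OF eig[OF this], of n] nonneg[OF eig[OF this]]
        show "- (1 / real (Suc n)) \<le> poly (p n) (Re (cinner (T d) d))" by simp
      qed simp
      also have "\<dots> = Re (cinner (op_poly (p n) T x) x)"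
        by (simp add: quad quadrature_quadratic_form)
      finally show ?thesis .
    qed
    moreover have "(\<lambda>n. Re (cinner (op_poly (p n) T x) x)) \<longlonglongrightarrow> Re (cinner (fun_calc f T x) x)"
      by (intro tendsto_intros lim_x)
    moreover have "(\<lambda>n. - (1 / real (Suc n)) * (norm x)\<^sup>2) \<longlonglongrightarrow> - 0 * (norm x)\<^sup>2"
      by (intro tendsto_intros null)
    ultimately show ?thesis
      using LIMSEQ_le[where X = "\<lambda>n. - (1 / real (Suc n)) * (norm x)\<^sup>2"] by fastforce
  qed
  ultimately show ?thesis by (simp add: positive_op_def bounded_ops_def)
qed

section \<open>Riesz representation, adjoints and orthonormal bases\<close>

text \<open>Minimise \<open>\<parallel>x\<parallel>\<^sup>2 - 2 \<phi>(x)\<close> over \<open>V\<close>. By the parallelogram law minimising sequences are Cauchy,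
  and stationarity at the limit \<open>z\<close> says \<open>\<phi> = \<langle>z, \<cdot>\<rangle>\<close> on \<open>V\<close>. For \<open>V = UNIV\<close> this is the Riesz
  theorem; for \<open>\<phi> = \<langle>x, \<cdot>\<rangle>\<close> it gives the orthogonal projection of \<open>x\<close> onto \<open>V\<close>.\<close>

lemma riesz_on_closed_subspace:
  fixes V :: "'a :: {real_inner, complete_space} set"
  assumes V: "closed V" "subspace V" and \<phi>: "bounded_linear \<phi>"
  obtains z where "z \<in> V" "\<And>v. v \<in> V \<Longrightarrow> \<phi> v = inner z v"
proof -
  interpret bounded_linear \<phi> by fact
  define J where "J x = (norm x)\<^sup>2 - 2 * \<phi> x" for x
  obtain K where K: "\<And>x. norm (\<phi> x) \<le> norm x * K" using bounded by blast
  have J_lower: "- K\<^sup>2 \<le> J x" for x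
  proof -
    have "\<phi> x \<le> norm x * K" using K[of x] by simp
    moreover have "0 \<le> (norm x - K)\<^sup>2" by simp
    ultimately show ?thesis by (simp add: J_def power2_diff)
  qed
  have bdd: "bdd_below (J ` V)" using J_lower by (auto intro!: bdd_belowI)
  define m where "m = Inf (J ` V)"
  have m_le: "m \<le> J v" if "v \<in> V" for v
    unfolding m_def using bdd that by (intro cInf_lower) auto
  have V0: "0 \<in> V" using V(2) by (rule subspace_0)
  have "\<exists>v\<in>V. J v < m + 1 / Suc n" for n
    using cInf_lessD[of "J ` V" "m + 1 / Suc n"] V0 by (auto simp: m_def)
  then obtain x where x: "\<And>n. x n \<in> V" "\<And>n. J (x n) < m + 1 / Suc n" by metis
  have dist: "(norm (x n - x k))\<^sup>2 \<le> 2 * (1 / Suc n) + 2 * (1 / Suc k)" for n k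
  proof -
    have "(1/2) *\<^sub>R (x n + x k) \<in> V" using x V(2) by (simp add: subspace_add subspace_scale)
    then have "m \<le> J ((1/2) *\<^sub>R (x n + x k))" by (rule m_le)
    moreover have "(norm (x n - x k))\<^sup>2 = 2 * J (x n) + 2 * J (x k) - 4 * J ((1/2) *\<^sub>R (x n + x k))"
      by (simp add: J_def power2_norm_eq_inner scaleR add inner_add_left inner_add_right
          inner_diff_left inner_diff_right inner_commute algebra_simps)
    ultimately show ?thesis using x(2)[of n] x(2)[of k] by linarith
  qed
  have "Cauchy x"
  proof (rule metric_CauchyI)
    fix e :: real assume e: "e > 0"
    then obtain N where N: "1 / real (Suc N) < e\<^sup>2 / 4"
      using reals_Archimedean[of "e\<^sup>2 / 4"] by (auto simp: inverse_eq_divide)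
    have "dist (x n) (x k) < e" if "n \<ge> N" "k \<ge> N" for n k
    proof -
      have "1 / real (Suc n) \<le> 1 / real (Suc N)" "1 / real (Suc k) \<le> 1 / real (Suc N)"
        using that by (simp_all add: frac_le)
      then have "(norm (x n - x k))\<^sup>2 < e\<^sup>2" using dist[of n k] N by linarith
      then show ?thesis using e by (simp add: dist_norm power2_less_imp_less)
    qed
    then show "\<exists>M. \<forall>n\<ge>M. \<forall>k\<ge>M. dist (x n) (x k) < e" by blast
  qed
  then obtain z where z: "x \<longlonglongrightarrow> z" using Cauchy_convergent convergent_def by blast
  have zV: "z \<in> V" using V(1) x(1) z by (metis closed_sequentially)
  have "(\<lambda>n. J (x n)) \<longlonglongrightarrow> J z" unfolding J_def by (intro tendsto_intros z tendsto)
  moreover have "(\<lambda>n. m + 1 / real (Suc n)) \<longlonglongrightarrow> m + 0"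
    using LIMSEQ_inverse_real_of_nat by (intro tendsto_intros) (simp add: inverse_eq_divide)
  ultimately have Jz: "J z \<le> m"
    using x(2) by (intro LIMSEQ_le[where X = "\<lambda>n. J (x n)" and x = "J z" and y = m]) (auto intro: less_imp_le)
  have "\<phi> v = inner z v" if v: "v \<in> V" for v
  proof -
    have "2 * (\<phi> v - inner z v) * t \<le> (norm v)\<^sup>2 * t\<^sup>2" for t
    proof -
      have "z + t *\<^sub>R v \<in> V" using zV v V(2) by (simp add: subspace_add subspace_scale)
      then have "J z \<le> J (z + t *\<^sub>R v)" using Jz m_le by fastforce
      moreover have "(norm (z + t *\<^sub>R v))\<^sup>2 = (norm z)\<^sup>2 + 2 * t * inner z v + t\<^sup>2 * (norm v)\<^sup>2"
        unfolding power2_norm_eq_inner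
        by (simp add: inner_add_left inner_add_right inner_commute power2_eq_square)
      ultimately show ?thesis by (simp add: J_def scaleR add algebra_simps)
    qed
    from linear_le_square_imp_zero[OF this] show ?thesis by simp
  qed
  with zV that show thesis by blast
qed

text \<open>The source of both the adjoint and the Pettis integral.\<close>

lemma bounded_bilinear_representation:
  fixes b :: "'a :: complex_hilbert \<Rightarrow> 'b :: complex_hilbert \<Rightarrow> real"
  assumes b: "bounded_bilinear b"
  shows "\<exists>S :: 'a \<Rightarrow>\<^sub>L 'b. \<forall>x y. inner (S x) y = b x y"
proof -
  interpret bounded_bilinear b by fact
  have "\<exists>z. \<forall>y. b x y = inner z y" for x
    by (rule riesz_on_closed_subspace[OF _ _ bounded_linear_right, of UNIV]) auto
  then obtain S where S: "\<And>x y. b x y = inner (S x) y" by metis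
  obtain K where K: "0 < K" "\<And>x y. norm (b x y) \<le> norm x * norm y * K" using pos_bounded by blast
  have "bounded_linear S"
  proof (rule bounded_linear_intro[where K = K])
    show "S (x + y) = S x + S y" for x y
      by (rule iffD1[OF vector_eq_rdot], rule allI) (simp add: inner_add_left add_left flip: S)
    show "S (r *\<^sub>R x) = r *\<^sub>R S x" for r x
      by (rule iffD1[OF vector_eq_rdot], rule allI) (simp add: scaleR_left flip: S)
    show "norm (S x) \<le> norm x * K" for x
    proof -
      have "norm (S x) * norm (S x) = b x (S x)" by (simp add: S norm_eq_sqrt_inner)
      also have "\<dots> \<le> norm x * norm (S x) * K" using K(2)[of x "S x"] by simp
      finally have "norm (S x) * norm (S x) \<le> norm (S x) * (norm x * K)" by (simp add: mult_ac)
      then show ?thesis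
        using K(1) by (cases "norm (S x) = 0") (auto simp: mult_le_cancel_left)
    qed
  qed
  then show ?thesis by (intro exI[of _ "Blinfun S"]) (simp add: bounded_linear_Blinfun_apply S)
qed

text \<open>The adjoint with respect to the real inner product is the complex adjoint: the imaginary parts
  agree by evaluating the real identity at \<open>- \<i> x\<close>.\<close>

lemma hilbert_adjoint:
  fixes A :: "'a :: complex_hilbert \<Rightarrow>\<^sub>L 'b :: complex_hilbert"
  assumes A: "A \<in> bounded_ops"
  shows "hilbert_adjoint A \<in> bounded_ops \<and> (\<forall>x y. cinner (A x) y = cinner x (hilbert_adjoint A y))"
proof -
  have "bounded_bilinear (\<lambda>y x. inner y (A x))"
    by (rule bounded_bilinear.comp[OF bounded_bilinear_inner bounded_linear_ident
          blinfun.bounded_linear_right])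
  from bounded_bilinear_representation[OF this] obtain B :: "'b \<Rightarrow>\<^sub>L 'a"
    where B: "\<And>x y. inner (B y) x = inner y (A x)" by blast
  have Im_left: "Im (cinner u v) = inner ((- \<i>) *\<^sub>C u) v" for u v :: "'c :: complex_inner"
    by (simp add: Re_cinner[symmetric] cinner_scaleC_left)
  have adj: "cinner (A x) y = cinner x (B y)" for x y
  proof (rule complex_eqI)
    show "Re (cinner (A x) y) = Re (cinner x (B y))"
      using B[of y x] by (simp add: Re_cinner inner_commute)
    show "Im (cinner (A x) y) = Im (cinner x (B y))"
      using B[of y "(- \<i>) *\<^sub>C x"] by (simp add: Im_left bounded_ops_scaleC[OF A] inner_commute)
  qed
  have ext: "u = v" if "\<And>x. cinner x u = cinner x v" for u v :: 'a
  proof (rule cinner_ext)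
    fix z show "cinner u z = cinner v z"
      using that[of z] cinner_commute[of u z] cinner_commute[of v z] by simp
  qed
  have "B (c *\<^sub>C y) = c *\<^sub>C B y" for c y
    by (rule ext) (simp add: cinner_scaleC_right flip: adj)
  then have "B \<in> bounded_ops" by (simp add: bounded_ops_def)
  moreover have "B' = B" if "\<forall>x y. cinner (A x) y = cinner x (B' y)" for B' :: "'b \<Rightarrow>\<^sub>L 'a"
    by (rule blinfun_eqI, rule ext) (use that adj in metis)
  ultimately have "\<exists>!B. B \<in> bounded_ops \<and> (\<forall>x y. cinner (A x) y = cinner x (B y))"
    using adj by blast
  from theI'[OF this] show ?thesis unfolding hilbert_adjoint_def .
qed

lemma cinner_hilbert_adjoint_right:
  fixes A :: "'a :: complex_hilbert \<Rightarrow>\<^sub>L 'b :: complex_hilbert"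
  shows "A \<in> bounded_ops \<Longrightarrow> cinner x (hilbert_adjoint A y) = cinner (A x) y"
  using hilbert_adjoint by metis

lemma cinner_hilbert_adjoint_left:
  fixes A :: "'a :: complex_hilbert \<Rightarrow>\<^sub>L 'b :: complex_hilbert"
  shows "A \<in> bounded_ops \<Longrightarrow> cinner (hilbert_adjoint A y) x = cinner y (A x)"
  using cinner_hilbert_adjoint_right[of A x y] cinner_commute[of "hilbert_adjoint A y" x]
    cinner_commute[of y "A x"] by simp

lemma cinner_adjoint_comp:
  fixes A :: "'a :: complex_hilbert \<Rightarrow>\<^sub>L 'b :: complex_hilbert"
  shows "A \<in> bounded_ops \<Longrightarrow> cinner ((hilbert_adjoint A o\<^sub>L A) x) y = cinner (A x) (A y)"
  by (simp add: cinner_hilbert_adjoint_left)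

lemma positive_op_adjoint_comp:
  fixes A :: "'a :: complex_hilbert \<Rightarrow>\<^sub>L 'b :: complex_hilbert"
  assumes A: "A \<in> bounded_ops"
  shows "positive_op (hilbert_adjoint A o\<^sub>L A)"
proof -
  have "hilbert_adjoint A o\<^sub>L A \<in> bounded_ops"
    using A hilbert_adjoint[OF A] by (simp add: bounded_ops_def)
  then show ?thesis
    using A by (simp add: positive_op_def cinner_hilbert_adjoint_left cinner_hilbert_adjoint_right
        Re_cinner_self)
qed

lemma orthonormal_basis_iff:
  "orthonormal_basis E \<longleftrightarrow> orthonormal_on E (\<lambda>e. e) \<and> closure (module.span scaleC E) = UNIV"
proof -
  have "orthonormal_on E (\<lambda>e. e) \<longleftrightarrow>
      (\<forall>e\<in>E. norm e = 1) \<and> (\<forall>e\<in>E. \<forall>e'\<in>E. e \<noteq> e' \<longrightarrow> cinner e e' = 0)"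
    using orthonormal_on_norm[of E "\<lambda>e. e"]
    by (auto simp: orthonormal_on_def cinner_self)
  then show ?thesis by (auto simp: orthonormal_basis_def)
qed

lemma subspace_closure:
  fixes V :: "'a :: real_normed_vector set"
  assumes V: "subspace V"
  shows "subspace (closure V)"
proof (rule subspaceI)
  show "0 \<in> closure V" using subspace_0[OF V] closure_subset by blast
  show "x + y \<in> closure V" if xy: "x \<in> closure V" "y \<in> closure V" for x y
  proof -
    from xy obtain f g where f: "\<And>n. f n \<in> V" "f \<longlonglongrightarrow> x" and g: "\<And>n. g n \<in> V" "g \<longlonglongrightarrow> y"
      unfolding closure_sequential by blast
    have "(\<lambda>n. f n + g n) \<longlonglongrightarrow> x + y" by (intro tendsto_add f g)
    moreover have "f n + g n \<in> V" for n by (intro subspace_add V f g)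
    ultimately show ?thesis unfolding closure_sequential by (intro exI[of _ "\<lambda>n. f n + g n"]) simp
  qed
  show "c *\<^sub>R x \<in> closure V" if x: "x \<in> closure V" for c x
  proof -
    from x obtain f where f: "\<And>n. f n \<in> V" "f \<longlonglongrightarrow> x"
      unfolding closure_sequential by blast
    have "(\<lambda>n. c *\<^sub>R f n) \<longlonglongrightarrow> c *\<^sub>R x" by (intro tendsto_intros f)
    moreover have "c *\<^sub>R f n \<in> V" for n by (intro subspace_scale V f)
    ultimately show ?thesis unfolding closure_sequential by (intro exI[of _ "\<lambda>n. c *\<^sub>R f n"]) simp
  qed
qed

text \<open>A maximal orthonormal set is total: a vector outside the closed span has a nonzero component
  orthogonal to it.\<close>

lemma orthonormal_basis_exists: "\<exists>E :: 'a :: complex_hilbert set. orthonormal_basis E"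
proof -
  interpret cs: module "scaleC :: complex \<Rightarrow> 'a \<Rightarrow> 'a" by (rule module_scaleC)
  have "\<exists>E\<in>{E :: 'a set. orthonormal_on E (\<lambda>e. e)}. \<forall>F\<in>{E. orthonormal_on E (\<lambda>e. e)}. E \<subseteq> F \<longrightarrow> F = E"
  proof (rule subset_Zorn')
    fix C :: "'a set set" assume C: "subset.chain {E. orthonormal_on E (\<lambda>e. e)} C"
    have "cinner x y = (if x = y then 1 else 0)" if xy: "x \<in> \<Union>C" "y \<in> \<Union>C" for x y
    proof -
      from xy obtain E1 E2 where E12: "E1 \<in> C" "x \<in> E1" "E2 \<in> C" "y \<in> E2" by blast
      then have "E1 \<subseteq> E2 \<or> E2 \<subseteq> E1" using C unfolding subset_chain_def by blast
      with E12 obtain E where "E \<in> C" "x \<in> E" "y \<in> E" by blast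
      moreover have "orthonormal_on E (\<lambda>e. e)" using C \<open>E \<in> C\<close> by (auto simp: subset.chain_def)
      ultimately show ?thesis by (auto simp: orthonormal_on_def)
    qed
    then show "\<Union>C \<in> {E. orthonormal_on E (\<lambda>e. e)}" by (simp add: orthonormal_on_def)
  qed
  then obtain E :: "'a set" where E: "orthonormal_on E (\<lambda>e. e)"
    and max: "\<And>F. orthonormal_on F (\<lambda>e. e) \<Longrightarrow> E \<subseteq> F \<Longrightarrow> F = E" by auto
  have "x \<in> closure (cs.span E)" for x
  proof -
    have "subspace (cs.span E)"
      by (intro subspaceI) (auto simp: cs.span_zero cs.span_add scaleR_scaleC cs.span_scale)
    then have V: "closed (closure (cs.span E))" "subspace (closure (cs.span E))"
      by (simp_all add: subspace_closure)
    obtain z where z: "z \<in> closure (cs.span E)" "\<And>v. v \<in> closure (cs.span E) \<Longrightarrow> inner x v = inner z v"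
      using riesz_on_closed_subspace[OF V bounded_linear_inner_right[of x]] by blast
    have perp: "cinner (x - z) e = 0" if "e \<in> E" for e
    proof (rule complex_eqI)
      have "e \<in> closure (cs.span E)" "\<i> *\<^sub>C e \<in> closure (cs.span E)"
        using that closure_subset cs.span_base cs.span_scale by blast+
      then show "Re (cinner (x - z) e) = Re 0" "Im (cinner (x - z) e) = Im 0"
        by (simp_all add: Re_cinner Im_cinner inner_diff_left z(2))
    qed
    have "x = z"
    proof (rule ccontr)
      assume neq: "x \<noteq> z"
      define y where "y = (1 / norm (x - z)) *\<^sub>R (x - z)"
      have y1: "norm y = 1" using neq by (simp add: y_def)
      have yE: "cinner y e = 0" if "e \<in> E" for e
        using perp[OF that] by (simp add: y_def cinner_scaleR_left)
      have "y \<in> E" using max[OF orthonormal_on_insert[OF E y1 yE]] by blast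
      from yE[OF this] y1 show False by (simp add: cinner_self)
    qed
    then show ?thesis using z(1) by simp
  qed
  then show ?thesis using E by (auto simp: orthonormal_basis_iff)
qed

text \<open>A vector of the dense span lies in the span of a finite part of \<open>E\<close>, and the projection onto
  that part is at least as close to \<open>x\<close>.\<close>

lemma orthonormal_basis_approx:
  fixes E :: "'a :: complex_hilbert set"
  assumes E: "orthonormal_basis E" and X: "finite X" and e: "0 < e"
  shows "\<exists>E0\<subseteq>E. finite E0 \<and> (\<forall>x\<in>X. norm (x - proj_on E0 (\<lambda>b. b) x) < e)"
proof -
  interpret cs: module "scaleC :: complex \<Rightarrow> 'a \<Rightarrow> 'a" by (rule module_scaleC)
  have on: "orthonormal_on E0 (\<lambda>b. b)" if "E0 \<subseteq> E" for E0
    using E that by (auto simp: orthonormal_basis_iff orthonormal_on_def subset_eq)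
  have mono: "proj_on E2 (\<lambda>b. b) x = x"
    if "proj_on E1 (\<lambda>b. b) x = x" "E1 \<subseteq> E2" "E2 \<subseteq> E" "finite E2" for E1 E2 x
    by (rule proj_on_span_mono[OF that(1) on[OF that(3)] that(4)])
      (use that proj_on_member[OF on[OF that(3)] that(4)] in auto)
  have span: "\<exists>E0\<subseteq>E. finite E0 \<and> proj_on E0 (\<lambda>b. b) y = y" if "y \<in> cs.span E" for y
    using that
  proof (induction rule: cs.span_induct_alt)
    case base
    show ?case by (rule exI[of _ "{}"]) simp
  next
    case (step c x y)
    then obtain E0 where E0: "E0 \<subseteq> E" "finite E0" "proj_on E0 (\<lambda>b. b) y = y" by blast
    have fin: "finite (insert x E0)" and sub: "insert x E0 \<subseteq> E" using E0 step by auto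
    have "proj_on (insert x E0) (\<lambda>b. b) y = y" by (rule mono[OF E0(3) _ sub fin]) auto
    moreover have "proj_on (insert x E0) (\<lambda>b. b) x = x"
      using proj_on_member[OF on[OF sub] fin, of x] by simp
    ultimately have "proj_on (insert x E0) (\<lambda>b. b) (c *\<^sub>C x + y) = c *\<^sub>C x + y"
      by (simp add: proj_on_add proj_on_scaleC)
    then show ?case using fin sub by blast
  qed
  have "\<exists>E0\<subseteq>E. finite E0 \<and> norm (x - proj_on E0 (\<lambda>b. b) x) < e" for x
  proof -
    have "x \<in> closure (cs.span E)" using E by (simp add: orthonormal_basis_def)
    then obtain y where y: "y \<in> cs.span E" "dist y x < e"
      using e by (auto simp: closure_approachable)
    from span[OF y(1)] obtain E0 where E0: "E0 \<subseteq> E" "finite E0" "proj_on E0 (\<lambda>b. b) y = y" by blast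
    from proj_on_best_approximation[OF on[OF E0(1)] E0(2,3), of x] y(2)
    have "norm (x - proj_on E0 (\<lambda>b. b) x) < e" by (simp add: dist_norm norm_minus_commute)
    then show ?thesis using E0 by blast
  qed
  then obtain E0 where E0: "\<And>x. E0 x \<subseteq> E" "\<And>x. finite (E0 x)"
    "\<And>x. norm (x - proj_on (E0 x) (\<lambda>b. b) x) < e" by metis
  let ?E = "\<Union>x\<in>X. E0 x"
  have sub: "?E \<subseteq> E" and fin: "finite ?E" using E0 X by auto
  have "norm (x - proj_on ?E (\<lambda>b. b) x) < e" if "x \<in> X" for x
  proof -
    have "proj_on ?E (\<lambda>b. b) (proj_on (E0 x) (\<lambda>b. b) x) = proj_on (E0 x) (\<lambda>b. b) x"
      by (rule mono[OF _ _ sub fin])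
        (use that in \<open>auto intro: proj_on_idem[OF on[OF E0(1)] E0(2)]\<close>)
    from proj_on_best_approximation[OF on[OF sub] fin this, of x] E0(3)[of x]
    show ?thesis by linarith
  qed
  then show ?thesis using sub fin by blast
qed

section \<open>Traces of positive operators\<close>

lemma compression_quadratic_form:
  fixes T :: "'a :: complex_inner \<Rightarrow>\<^sub>L 'a"
  assumes T: "positive_op T" and D: "finite D" "orthonormal_on D (\<lambda>d. d)"
    and diag: "\<And>d d'. d \<in> D \<Longrightarrow> d' \<in> D \<Longrightarrow> d \<noteq> d' \<Longrightarrow> cinner (T d) d' = 0"
    and y: "proj_on D (\<lambda>d. d) y = y"
  shows "Re (cinner (T y) y) = (\<Sum>d\<in>D. Re (cinner (T d) d) * (norm (cinner y d))\<^sup>2)"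
proof -
  have "cinner (T y) y = cinner (T y) (proj_on D (\<lambda>d. d) y)" by (simp add: y)
  also have "\<dots> = (\<Sum>d\<in>D. cnj (cinner y d) * cinner (T y) d)"
    by (simp add: proj_on_def cinner_sum_right cinner_scaleC_right)
  also have "\<dots> = (\<Sum>d\<in>D. of_real (Re (cinner (T d) d) * (norm (cinner y d))\<^sup>2))"
    by (rule sum.cong[OF refl])
      (simp add: eigenvector_of_compression[OF T D diag y] complex_norm_square of_real_mult
        mult_ac del: of_real_power)
  finally show ?thesis by simp
qed

text \<open>In the eigenbasis \<open>D\<close> of the compression of \<open>R\<close> to the span of \<open>E\<close> both sides are sums over \<open>D\<close>:
  Bessel's inequality for \<open>g\<close> gives each eigenvalue at most the weight one on the left, and on the
  right the weight is exactly one.\<close>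

lemma bessel_sum_le_finite_trace:
  fixes R :: "'a :: complex_inner \<Rightarrow>\<^sub>L 'a"
  assumes R: "positive_op R" and E: "finite E" "orthonormal_on E (\<lambda>e. e)"
    and bessel: "\<And>x. (\<Sum>i\<in>I. (norm (cinner x (g i)))\<^sup>2) \<le> (norm x)\<^sup>2"
  shows "(\<Sum>i\<in>I. Re (cinner (R (proj_on E (\<lambda>e. e) (g i))) (proj_on E (\<lambda>e. e) (g i))))
    \<le> (\<Sum>e\<in>E. Re (cinner (R e) e))"
proof -
  from compression_diagonalisation[OF R E] obtain D
    where D: "finite D" "orthonormal_on D (\<lambda>d. d)" and DE: "\<forall>d\<in>D. proj_on E (\<lambda>e. e) d = d"
      and ED: "\<forall>e\<in>E. proj_on D (\<lambda>d. d) e = e"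
      and diag': "\<forall>d\<in>D. \<forall>d'\<in>D. d \<noteq> d' \<longrightarrow> cinner (R d) d' = 0"
    by (elim exE conjE) (rule that)
  note diag = diag'[rule_format]
  define l where "l d = Re (cinner (R d) d)" for d
  let ?P = "proj_on E (\<lambda>e. e)"
  have "(\<Sum>i\<in>I. Re (cinner (R (?P (g i))) (?P (g i)))) = (\<Sum>i\<in>I. \<Sum>d\<in>D. l d * (norm (cinner d (g i)))\<^sup>2)"
  proof (rule sum.cong[OF refl])
    fix i assume "i \<in> I"
    have "proj_on D (\<lambda>d. d) (?P (g i)) = ?P (g i)"
      by (rule proj_on_span_mono[OF proj_on_idem[OF E(2,1)] D(2,1)]) (use ED in simp)
    from compression_quadratic_form[OF R D diag this]
    have "Re (cinner (R (?P (g i))) (?P (g i))) = (\<Sum>d\<in>D. l d * (norm (cinner (?P (g i)) d))\<^sup>2)"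
      by (simp add: l_def)
    also have "\<dots> = (\<Sum>d\<in>D. l d * (norm (cinner d (g i)))\<^sup>2)"
      by (rule sum.cong[OF refl])
        (use DE in \<open>simp add: cinner_proj_on_commute[OF E(2,1)] norm_cinner_commute\<close>)
    finally show "Re (cinner (R (?P (g i))) (?P (g i))) = (\<Sum>d\<in>D. l d * (norm (cinner d (g i)))\<^sup>2)" .
  qed
  also have "\<dots> = (\<Sum>d\<in>D. l d * (\<Sum>i\<in>I. (norm (cinner d (g i)))\<^sup>2))"
    by (subst sum.swap) (simp add: sum_distrib_left)
  also have "\<dots> \<le> (\<Sum>d\<in>D. l d * (norm d)\<^sup>2)"
    by (intro sum_mono mult_left_mono bessel) (simp add: l_def positive_op_nonneg[OF R])
  also have "\<dots> = (\<Sum>d\<in>D. l d * (norm (?P d))\<^sup>2)"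
    by (rule sum.cong[OF refl]) (use DE in simp)
  also have "\<dots> = (\<Sum>d\<in>D. l d * (\<Sum>e\<in>E. (norm (cinner e d))\<^sup>2))"
    by (simp add: norm_proj_on[OF E(2,1)] norm_cinner_commute)
  also have "\<dots> = (\<Sum>e\<in>E. \<Sum>d\<in>D. l d * (norm (cinner e d))\<^sup>2)"
    by (subst sum.swap) (simp add: sum_distrib_left)
  also have "\<dots> = (\<Sum>e\<in>E. Re (cinner (R e) e))"
    by (rule sum.cong[OF refl]) (use ED in \<open>simp add: compression_quadratic_form[OF R D diag] l_def\<close>)
  finally show ?thesis .
qed

text \<open>Finite parts of the basis approximate all the \<open>g i\<close> at once, so the finite-dimensional
  inequality passes to the limit.\<close>

lemma bessel_sum_le_trace:
  fixes R :: "'a :: complex_hilbert \<Rightarrow>\<^sub>L 'a"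
  assumes R: "positive_op R" and E: "orthonormal_basis E" and I: "finite I"
    and bessel: "\<And>x. (\<Sum>i\<in>I. (norm (cinner x (g i)))\<^sup>2) \<le> (norm x)\<^sup>2"
  shows "ennreal (\<Sum>i\<in>I. Re (cinner (R (g i)) (g i))) \<le> (\<Sum>\<^sub>\<infinity>e\<in>E. ennreal (Re (cinner (R e) e)))"
    (is "_ \<le> ?tr")
proof (cases ?tr)
  case (real t)
  have "\<exists>E0\<subseteq>E. finite E0 \<and> (\<forall>i\<in>I. norm (g i - proj_on E0 (\<lambda>b. b) (g i)) < 1 / Suc n)" for n
    using orthonormal_basis_approx[OF E, of "g ` I" "1 / Suc n"] I by simp
  then obtain E0 where E0: "\<And>n. E0 n \<subseteq> E" "\<And>n. finite (E0 n)"
    "\<And>n i. i \<in> I \<Longrightarrow> norm (g i - proj_on (E0 n) (\<lambda>b. b) (g i)) < 1 / Suc n" by metis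
  define P where "P n = proj_on (E0 n) (\<lambda>b. b)" for n
  have lim: "(\<lambda>n. P n (g i)) \<longlonglongrightarrow> g i" if "i \<in> I" for i
  proof -
    have "(\<lambda>n. g i - P n (g i)) \<longlonglongrightarrow> 0"
    proof (rule Lim_null_comparison)
      show "\<forall>\<^sub>F n in sequentially. norm (g i - P n (g i)) \<le> inverse (real (Suc n))"
        using E0(3)[OF that] by (intro always_eventually allI) (simp add: P_def inverse_eq_divide less_imp_le)
    qed (rule LIMSEQ_inverse_real_of_nat)
    from tendsto_diff[OF tendsto_const[of "g i"] this] show ?thesis by simp
  qed
  have le_t: "(\<Sum>i\<in>I. Re (cinner (R (P n (g i))) (P n (g i)))) \<le> t" for n
  proof -
    have on: "orthonormal_on (E0 n) (\<lambda>b. b)"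
      using E E0(1)[of n] by (auto simp: orthonormal_basis_iff orthonormal_on_def subset_eq)
    have "ennreal (\<Sum>e\<in>E0 n. Re (cinner (R e) e)) = (\<Sum>e\<in>E0 n. ennreal (Re (cinner (R e) e)))"
      by (simp add: positive_op_nonneg[OF R] sum_ennreal)
    also have "\<dots> \<le> ?tr"
      by (subst nonneg_infsum_complete) (use E0 in \<open>auto intro!: SUP_upper\<close>)
    finally have "(\<Sum>e\<in>E0 n. Re (cinner (R e) e)) \<le> t" using real by simp
    with bessel_sum_le_finite_trace[OF R E0(2) on bessel] show ?thesis
      unfolding P_def by linarith
  qed
  have "(\<lambda>n. \<Sum>i\<in>I. Re (cinner (R (P n (g i))) (P n (g i)))) \<longlonglongrightarrow> (\<Sum>i\<in>I. Re (cinner (R (g i)) (g i)))"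
    by (intro tendsto_intros lim)
  then have "(\<Sum>i\<in>I. Re (cinner (R (g i)) (g i))) \<le> t"
    by (rule LIMSEQ_le_const2) (use le_t in blast)
  then show ?thesis using real by (simp add: ennreal_leI)
qed simp

section \<open>Convexity inequalities for real powers\<close>

text \<open>The convex function \<open>t\<^sup>r / r\<close> lies above its tangent at \<open>s\<close>.\<close>

lemma young_tangent:
  fixes r s y :: real
  assumes "1 \<le> r" "0 \<le> s" "0 \<le> y"
  shows "r * (s powr (r - 1) * y) \<le> (r - 1) * s powr r + y powr r"
proof (cases "s = 0 \<or> y = 0")
  case False
  then have "(s powr r) powr ((r - 1) / r) * (y powr r) powr (1 / r)
      \<le> (r - 1) / r * s powr r + 1 / r * y powr r"
    using assms by (intro Youngs_inequality_0) (auto simp: field_simps)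
  also have "(s powr r) powr ((r - 1) / r) = s powr (r - 1)" using assms by (simp add: powr_powr)
  also have "(y powr r) powr (1 / r) = y" using assms by (simp add: powr_powr)
  finally have "r * (s powr (r - 1) * y) \<le> r * ((r - 1) / r * s powr r + 1 / r * y powr r)"
    using assms by (intro mult_left_mono) auto
  then show ?thesis using assms by (simp add: distrib_left)
qed (use assms in auto)

text \<open>Jensen's inequality for \<open>t\<^sup>r\<close> with weights of total mass at most one: sum the tangent
  inequality at the weighted mean.\<close>

lemma subprobability_jensen_powr:
  fixes w y :: "'i \<Rightarrow> real"
  assumes r: "1 \<le> r" and w: "\<And>i. i \<in> I \<Longrightarrow> 0 \<le> w i" "sum w I \<le> 1"
    and y: "\<And>i. i \<in> I \<Longrightarrow> 0 \<le> y i"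
  shows "(\<Sum>i\<in>I. w i * y i) powr r \<le> (\<Sum>i\<in>I. w i * y i powr r)"
proof -
  define s where "s = (\<Sum>i\<in>I. w i * y i)"
  have s: "0 \<le> s" using w y by (auto simp: s_def intro!: sum_nonneg)
  have "r * s powr r = r * (s powr (r - 1) * s)"
    using s powr_mult_base[of s "r - 1"] by (simp add: mult.commute)
  also have "\<dots> = (\<Sum>i\<in>I. w i * (r * (s powr (r - 1) * y i)))"
    using sum_distrib_left[of "r * s powr (r - 1)" "\<lambda>i. w i * y i" I]
    unfolding s_def[symmetric] by (simp add: mult_ac)
  also have "\<dots> \<le> (\<Sum>i\<in>I. w i * ((r - 1) * s powr r + y i powr r))"
    using r w y s by (intro sum_mono mult_left_mono young_tangent) auto
  also have "\<dots> = sum w I * ((r - 1) * s powr r) + (\<Sum>i\<in>I. w i * y i powr r)"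
    by (simp add: distrib_left sum.distrib sum_distrib_right)
  also have "\<dots> \<le> 1 * ((r - 1) * s powr r) + (\<Sum>i\<in>I. w i * y i powr r)"
    using r w by (intro add_right_mono mult_right_mono) auto
  finally show ?thesis by (simp add: s_def algebra_simps)
qed

text \<open>Hoelder's inequality for \<open>b\<close> against the normalised dual vector of \<open>a\<close>.\<close>

lemma holder_dual_vector:
  fixes a b :: "'i \<Rightarrow> real"
  assumes r: "1 \<le> r" and a: "\<And>i. i \<in> I \<Longrightarrow> 0 \<le> a i" and b: "\<And>i. i \<in> I \<Longrightarrow> 0 \<le> b i"
    and N: "0 < N" "(\<Sum>i\<in>I. a i powr r) = N powr r"
    and B: "0 \<le> B" "(\<Sum>i\<in>I. b i powr r) \<le> B powr r" and I: "finite I"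
  shows "(\<Sum>i\<in>I. (a i / N) powr (r - 1) * b i) \<le> B"
proof (cases "B = 0")
  case True
  then have "(\<Sum>i\<in>I. b i powr r) = 0" using B by (intro antisym sum_nonneg) auto
  then have "b i = 0" if "i \<in> I" for i
    using sum_nonneg_eq_0_iff[OF I, of "\<lambda>i. b i powr r"] that by simp
  then show ?thesis using True by simp
next
  case False
  then have B0: "0 < B" using B by simp
  have "r * (\<Sum>i\<in>I. (a i / N) powr (r - 1) * (b i / B))
      = (\<Sum>i\<in>I. r * ((a i / N) powr (r - 1) * (b i / B)))"
    by (simp add: sum_distrib_left)
  also have "\<dots> \<le> (\<Sum>i\<in>I. (r - 1) * (a i / N) powr r + (b i / B) powr r)"
    using a b N B0 r by (intro sum_mono young_tangent) auto
  also have "\<dots> = (r - 1) * (\<Sum>i\<in>I. (a i / N) powr r) + (\<Sum>i\<in>I. (b i / B) powr r)"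
    by (simp add: sum.distrib sum_distrib_left)
  also have "(\<Sum>i\<in>I. (a i / N) powr r) = 1"
  proof -
    have "(\<Sum>i\<in>I. (a i / N) powr r) = (\<Sum>i\<in>I. a i powr r) / N powr r"
      unfolding sum_divide_distrib by (rule sum.cong[OF refl]) (use a N in \<open>simp add: powr_divide\<close>)
    then show ?thesis using N by simp
  qed
  also have "(\<Sum>i\<in>I. (b i / B) powr r) \<le> 1"
  proof -
    have "(\<Sum>i\<in>I. (b i / B) powr r) = (\<Sum>i\<in>I. b i powr r) / B powr r"
      unfolding sum_divide_distrib by (rule sum.cong[OF refl]) (use b B0 in \<open>simp add: powr_divide\<close>)
    then show ?thesis using B B0 by (simp add: divide_le_eq)
  qed
  finally have "(\<Sum>i\<in>I. (a i / N) powr (r - 1) * (b i / B)) \<le> 1" using r by simp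
  then show ?thesis
    using B0 by (simp add: sum_divide_distrib[symmetric] divide_le_eq)
qed

section \<open>Schatten norms and matrix elements\<close>

text \<open>A polynomial substitute \<open>m\<close> for \<open>t\<^bsup>-1/2\<^esup>\<close>, obtained by approximating \<open>(t + \<delta>)\<^bsup>-1/2\<^esup>\<close> uniformly. The
  first bound makes \<open>A m(A\<^sup>* A)\<close> a contraction. By the second, replacing the factor one by \<open>t m(t)\<^sup>2\<close>
  costs little in the presence of \<open>t\<^bsup>r/2\<^esup>\<close>, where small \<open>t\<close> do not matter.\<close>

lemma inverse_sqrt_poly:
  fixes M r \<eta> :: real
  assumes M: "0 \<le> M" and r: "1 \<le> r" and \<eta>: "0 < \<eta>"
  obtains m :: "real poly" where "\<And>t. t \<in> {0..M} \<Longrightarrow> t * (poly m t)\<^sup>2 \<le> 1"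
    and "\<And>t. t \<in> {0..M} \<Longrightarrow> t powr (r / 2) * (1 - t * (poly m t)\<^sup>2) \<le> \<eta>"
proof -
  define K where "K = M powr ((r - 1) / 2) + 1"
  define L where "L = M powr (r / 2) + 1"
  have K: "1 \<le> K" and L: "1 \<le> L" by (auto simp: K_def L_def)
  \<comment> \<open>The arithmetic-geometric mean inequality bounds \<open>t\<^bsup>1/2\<^esup> \<delta> / (t + \<delta>)\<close> by \<open>\<delta>\<^bsup>1/2\<^esup> / 2\<close>; the factor \<open>K\<close>
    absorbs the remaining power of \<open>t\<close>.\<close>
  define \<delta> where "\<delta> = (\<eta> / K)\<^sup>2"
  have \<delta>: "0 < \<delta>" using K \<eta> by (simp add: \<delta>_def)
  have sqrt_\<delta>: "sqrt \<delta> = \<eta> / K" using K \<eta> by (simp add: \<delta>_def)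
  \<comment> \<open>The admissible error for \<open>t m(t)\<^sup>2\<close>: as \<open>t / (t + \<delta>)\<close> stays below one by at least
    \<open>\<delta> / (M + \<delta>)\<close>, the perturbed value is at most one.\<close>
  define \<kappa> where "\<kappa> = min (\<delta> / (M + \<delta>)) (\<eta> / (2 * L))"
  have \<kappa>: "0 < \<kappa>" using \<delta> M L \<eta> by (simp add: \<kappa>_def)
  define C where "C = M * (2 / sqrt \<delta> + 1) + 1"
  have C: "0 < C" using M \<delta> by (auto simp: C_def intro!: add_nonneg_pos)
  define \<epsilon> where "\<epsilon> = min 1 (\<kappa> / C)"
  have \<epsilon>: "0 < \<epsilon>" using \<kappa> C by (simp add: \<epsilon>_def)
  have "continuous_on {0..M} (\<lambda>t. 1 / sqrt (t + \<delta>))"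
    using \<delta> by (intro continuous_intros) (auto simp: add_nonneg_pos)
  from weierstrass_poly[OF this \<epsilon>] obtain m :: "real poly"
    where m: "\<And>t. t \<in> {0..M} \<Longrightarrow> \<bar>poly m t - 1 / sqrt (t + \<delta>)\<bar> \<le> \<epsilon>" by blast
  have close: "\<bar>t * (poly m t)\<^sup>2 - t / (t + \<delta>)\<bar> \<le> \<kappa>" if t: "t \<in> {0..M}" for t
  proof -
    define s where "s = 1 / sqrt (t + \<delta>)"
    have t\<delta>: "0 < t + \<delta>" using t \<delta> by auto
    have s: "0 < s" "s \<le> 1 / sqrt \<delta>" "s\<^sup>2 = 1 / (t + \<delta>)"
      using t \<delta> t\<delta> by (auto simp: s_def power_divide intro!: divide_left_mono)
    have d: "\<bar>poly m t - s\<bar> \<le> \<epsilon>" using m[OF t] by (simp add: s_def)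
    have "\<bar>poly m t + s\<bar> \<le> \<bar>poly m t - s\<bar> + 2 * s" using s(1) by linarith
    also have "\<dots> \<le> 1 + 2 / sqrt \<delta>" using d s(2) by (simp add: \<epsilon>_def)
    finally have "t * (\<bar>poly m t - s\<bar> * \<bar>poly m t + s\<bar>) \<le> M * (\<epsilon> * (1 + 2 / sqrt \<delta>))"
      using t d \<epsilon> by (intro mult_mono) auto
    also have "\<dots> \<le> \<epsilon> * C" using \<epsilon> by (simp add: C_def algebra_simps)
    also have "\<dots> \<le> \<kappa>" using C by (simp add: \<epsilon>_def field_simps min_def)
    finally have "t * (\<bar>poly m t - s\<bar> * \<bar>poly m t + s\<bar>) \<le> \<kappa>" .
    moreover have "t * (poly m t)\<^sup>2 - t / (t + \<delta>) = t * ((poly m t - s) * (poly m t + s))"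
    proof -
      have "t / (t + \<delta>) = t * s\<^sup>2" by (simp add: s(3))
      then show ?thesis by (simp add: power2_eq_square algebra_simps)
    qed
    ultimately show ?thesis using t by (simp add: abs_mult)
  qed
  have "t * (poly m t)\<^sup>2 \<le> 1" if t: "t \<in> {0..M}" for t
  proof -
    have "t / (t + \<delta>) = 1 - \<delta> / (t + \<delta>)" using t \<delta> by (simp add: field_simps)
    also have "\<dots> \<le> 1 - \<delta> / (M + \<delta>)"
      using t \<delta> M by (intro diff_left_mono divide_left_mono) (auto intro!: mult_pos_pos add_nonneg_pos)
    also have "\<dots> \<le> 1 - \<kappa>" by (simp add: \<kappa>_def)
    finally show ?thesis using close[OF t] by linarith
  qed
  moreover have "t powr (r / 2) * (1 - t * (poly m t)\<^sup>2) \<le> \<eta>" if t: "t \<in> {0..M}" for t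
  proof -
    have t0: "0 \<le> t" "t \<le> M" using t by auto
    have "1 - t * (poly m t)\<^sup>2 \<le> \<delta> / (t + \<delta>) + \<kappa>"
    proof -
      have "t / (t + \<delta>) = 1 - \<delta> / (t + \<delta>)" using t \<delta> by (simp add: field_simps)
      then show ?thesis using close[OF t] by linarith
    qed
    then have "t powr (r / 2) * (1 - t * (poly m t)\<^sup>2)
        \<le> t powr (r / 2) * (\<delta> / (t + \<delta>)) + t powr (r / 2) * \<kappa>"
      by (metis distrib_left mult_left_mono powr_ge_zero)
    also have "t powr (r / 2) * \<kappa> \<le> L * (\<eta> / (2 * L))"
      using t0 r L \<kappa> powr_mono2[of "r / 2" t M]
      by (intro mult_mono) (auto simp: \<kappa>_def L_def)
    also have "L * (\<eta> / (2 * L)) = \<eta> / 2" using L by simp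
    also have "t powr (r / 2) * (\<delta> / (t + \<delta>)) \<le> \<eta> / 2"
    proof -
      have "t powr (r / 2) = t powr ((r - 1) / 2) * sqrt t"
        using t0 by (simp add: powr_half_sqrt[symmetric] powr_add[symmetric] field_simps)
      also have "\<dots> \<le> K * sqrt t"
        using t0 r powr_mono2[of "(r - 1) / 2" t M] by (intro mult_right_mono) (auto simp: K_def)
      finally have 1: "t powr (r / 2) \<le> K * sqrt t" .
      have "0 \<le> (sqrt t - sqrt \<delta>)\<^sup>2" by simp
      then have "2 * sqrt t * sqrt \<delta> \<le> t + \<delta>" using t0 \<delta> by (simp add: power2_diff)
      then have "sqrt \<delta> * (2 * sqrt t * sqrt \<delta>) \<le> sqrt \<delta> * (t + \<delta>)"
        using \<delta> by (intro mult_left_mono) auto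
      moreover have "sqrt \<delta> * (2 * sqrt t * sqrt \<delta>) = 2 * (sqrt t * (sqrt \<delta> * sqrt \<delta>))"
        by (simp only: mult_ac)
      moreover have "sqrt \<delta> * sqrt \<delta> = \<delta>" using \<delta> by simp
      ultimately have "2 * (sqrt t * \<delta>) \<le> sqrt \<delta> * (t + \<delta>)" by simp
      then have "sqrt t * \<delta> \<le> sqrt \<delta> / 2 * (t + \<delta>)" by simp
      then have "sqrt t * (\<delta> / (t + \<delta>)) \<le> sqrt \<delta> / 2"
        using t0 \<delta> by (simp add: divide_le_eq)
      then have "K * (sqrt t * (\<delta> / (t + \<delta>))) \<le> K * (sqrt \<delta> / 2)"
        using K by (intro mult_left_mono) auto
      also have "\<dots> = \<eta> / 2" using K by (simp add: sqrt_\<delta>)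
      finally have "K * (sqrt t * (\<delta> / (t + \<delta>))) \<le> \<eta> / 2" .
      moreover have "t powr (r / 2) * (\<delta> / (t + \<delta>)) \<le> (K * sqrt t) * (\<delta> / (t + \<delta>))"
        using 1 t0 \<delta> by (intro mult_right_mono) auto
      ultimately show ?thesis by (metis mult.assoc order_trans)
    qed
    finally show ?thesis by simp
  qed
  ultimately show thesis using that by blast
qed

lemma continuous_on_powr_half:
  "0 < r \<Longrightarrow> continuous_on {0..M} (\<lambda>t :: real. t powr (r / 2))"
  by (intro continuous_on_powr' continuous_intros) auto

lemma positive_op_abs_op_powr:
  fixes A :: "'a :: complex_hilbert \<Rightarrow>\<^sub>L 'b :: complex_hilbert"
  assumes "A \<in> bounded_ops" "0 < r"
  shows "positive_op (abs_op_powr A r)"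
  unfolding abs_op_powr_def
  by (rule fun_calc_positive[OF positive_op_adjoint_comp[OF assms(1)] continuous_on_powr_half[OF assms(2)]]) simp

lemma op_poly_one: "op_poly 1 T x = x"
  by (simp add: op_poly_apply)

text \<open>The images of a diagonalising basis of a compression of \<open>A\<^sup>* A\<close> are orthogonal, so after
  normalisation they are the left singular vectors of the compression.\<close>

lemma orthonormal_singular_vectors:
  fixes A :: "'a :: complex_hilbert \<Rightarrow>\<^sub>L 'b :: complex_hilbert"
  assumes A: "A \<in> bounded_ops"
    and diag: "\<And>d d'. d \<in> D \<Longrightarrow> d' \<in> D \<Longrightarrow> d \<noteq> d' \<Longrightarrow> cinner ((hilbert_adjoint A o\<^sub>L A) d) d' = 0"
  shows "orthonormal_on {d \<in> D. A d \<noteq> 0} (\<lambda>d. (1 / norm (A d)) *\<^sub>R A d)"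
  unfolding orthonormal_on_def
proof (intro ballI)
  fix d d' assume d: "d \<in> {d \<in> D. A d \<noteq> 0}" "d' \<in> {d \<in> D. A d \<noteq> 0}"
  show "cinner ((1 / norm (A d)) *\<^sub>R A d) ((1 / norm (A d')) *\<^sub>R A d') = (if d = d' then 1 else 0)"
  proof (cases "d = d'")
    case True
    then show ?thesis
      using d by (simp add: cinner_scaleR_left cinner_scaleR_right cinner_self power2_eq_square)
  next
    case False
    then have "cinner (A d) (A d') = 0" using diag[of d d'] d cinner_adjoint_comp[OF A] by simp
    then show ?thesis using False by (simp add: cinner_scaleR_left cinner_scaleR_right)
  qed
qed

text \<open>The heart of the upper bound. With \<open>T = A\<^sup>* A\<close> and \<open>m(t) \<approx> t\<^bsup>-1/2\<^esup>\<close>, the operator \<open>V = A m(T)\<close>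
  is an approximate polar factor of \<open>A\<close>, and \<open>C\<close> is its adjoint. In the singular value decomposition
  of a Krylov compression, \<open>\<langle>A e, f\<rangle>\<close> is a sum of singular values \<open>\<lambda>\<^bsup>1/2\<^esup>\<close> whose coefficients are at
  most the mean of the squared coefficients of \<open>e\<close> and of \<open>f\<close>. Jensen's inequality then
  produces the quadratic form of \<open>|A|\<^sup>r\<close> at \<open>e\<close> and at \<open>C f\<close>.\<close>

lemma matrix_element_powr_bound:
  fixes A :: "'a :: complex_hilbert \<Rightarrow>\<^sub>L 'b :: complex_hilbert"
  assumes A: "A \<in> bounded_ops" and r: "1 \<le> r" and \<eta>: "0 < \<eta>"
  obtains V C where "\<And>x. norm (V x) \<le> norm x" "\<And>x f. cinner (V x) f = cinner x (C f)"
    and "\<And>e f. norm e \<le> 1 \<Longrightarrow> norm f \<le> 1 \<Longrightarrow> norm (cinner (A e) f) powr r \<le>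
      (Re (cinner (abs_op_powr A r e) e) + Re (cinner (abs_op_powr A r (C f)) (C f))) / 2 + 3 * \<eta>"
proof -
  define T where "T = hilbert_adjoint A o\<^sub>L A"
  have T: "positive_op T" unfolding T_def by (rule positive_op_adjoint_comp[OF A])
  have TA: "cinner (T x) y = cinner (A x) (A y)" for x y
    unfolding T_def by (rule cinner_adjoint_comp[OF A])
  define f where "f t = t powr (r / 2)" for t :: real
  have f: "continuous_on {0..norm T} f" unfolding f_def using r by (intro continuous_on_powr_half) simp
  have R: "abs_op_powr A r = fun_calc f T" by (simp add: abs_op_powr_def T_def f_def[abs_def])
  obtain q where q: "\<And>t. t \<in> {0..norm T} \<Longrightarrow> \<bar>poly q t - f t\<bar> \<le> \<eta>"
    using weierstrass_poly[OF f \<eta>] by blast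
  obtain m where m1: "\<And>t. t \<in> {0..norm T} \<Longrightarrow> t * (poly m t)\<^sup>2 \<le> 1"
    and m2: "\<And>t. t \<in> {0..norm T} \<Longrightarrow> f t * (1 - t * (poly m t)\<^sup>2) \<le> \<eta>"
    using inverse_sqrt_poly[OF norm_ge_zero r \<eta>] unfolding f_def by blast
  define V where "V x = A (op_poly m T x)" for x
  define C where "C y = op_poly m T (hilbert_adjoint A y)" for y
  have VC: "cinner (V x) y = cinner x (C y)" for x y
    by (simp add: V_def C_def op_poly_symmetric[OF T, symmetric] cinner_hilbert_adjoint_right[OF A])
  have V_le: "norm (V x) \<le> norm x" for x
  proof (rule krylov_quadrature[OF T, where X = "{x}" and n = "degree m"])
    fix D assume D: "finite D" "orthonormal_on D (\<lambda>d. d)"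
      and diag: "\<And>d d'. d \<in> D \<Longrightarrow> d' \<in> D \<Longrightarrow> d \<noteq> d' \<Longrightarrow> cinner (T d) d' = 0"
      and eig: "\<And>d. d \<in> D \<Longrightarrow> Re (cinner (T d) d) \<in> {0..norm T}"
      and quad: "\<And>y p. y \<in> {x} \<Longrightarrow> degree p \<le> degree m \<Longrightarrow>
        op_poly p T y = (\<Sum>d\<in>D. (complex_of_real (poly p (Re (cinner (T d) d))) * cinner y d) *\<^sub>C d)"
    let ?y = "op_poly m T x"
    have y: "?y = (\<Sum>d\<in>D. (complex_of_real (poly m (Re (cinner (T d) d))) * cinner x d) *\<^sub>C d)"
      by (rule quad) simp_all
    have "proj_on D (\<lambda>d. d) ?y = ?y" unfolding y by (rule proj_on_orthonormal_sum[OF D(2,1)])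
    from compression_quadratic_form[OF T D diag this]
    have "(norm (V x))\<^sup>2 = (\<Sum>d\<in>D. Re (cinner (T d) d) * (norm (cinner ?y d))\<^sup>2)"
      by (simp add: V_def TA Re_cinner_self)
    also have "\<dots> = (\<Sum>d\<in>D. (Re (cinner (T d) d) * (poly m (Re (cinner (T d) d)))\<^sup>2) * (norm (cinner x d))\<^sup>2)"
      by (rule sum.cong[OF refl])
        (simp add: y cinner_orthonormal_sum[OF D(2,1)] norm_mult power_mult_distrib)
    also have "\<dots> \<le> (\<Sum>d\<in>D. 1 * (norm (cinner x d))\<^sup>2)"
      by (intro sum_mono mult_right_mono m1 eig) auto
    also have "\<dots> \<le> (norm x)\<^sup>2" using bessel_inequality[OF D(2,1)] by simp
    finally show "norm (V x) \<le> norm x" by (rule power2_le_imp_le) simp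
  qed simp
  have C_le: "norm (C y) \<le> norm y" for y
  proof -
    have "norm (C y) * norm (C y) = Re (cinner (V (C y)) y)"
      by (simp add: VC Re_cinner_self power2_eq_square)
    also have "\<dots> \<le> norm (cinner (V (C y)) y)" by (rule complex_Re_le_cmod)
    also have "\<dots> \<le> norm (V (C y)) * norm y" by (rule norm_cinner_le)
    also have "\<dots> \<le> norm (C y) * norm y" by (intro mult_right_mono V_le) simp
    finally show ?thesis by (cases "C y = 0") simp_all
  qed
  have "norm (cinner (A e) y) powr r \<le>
      (Re (cinner (fun_calc f T e) e) + Re (cinner (fun_calc f T (C y)) (C y))) / 2 + 3 * \<eta>"
    if e: "norm e \<le> 1" and y: "norm y \<le> 1" for e y
  proof (rule krylov_quadrature[OF T, where X = "{e, hilbert_adjoint A y, C y}"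
        and n = "max (degree m) (degree q)"])
    define b where "b = hilbert_adjoint A y"
    fix D assume D: "finite D" "orthonormal_on D (\<lambda>d. d)"
      and diag: "\<And>d d'. d \<in> D \<Longrightarrow> d' \<in> D \<Longrightarrow> d \<noteq> d' \<Longrightarrow> cinner (T d) d' = 0"
      and eig: "\<And>d. d \<in> D \<Longrightarrow> Re (cinner (T d) d) \<in> {0..norm T}"
      and quad: "\<And>x p. x \<in> {e, hilbert_adjoint A y, C y} \<Longrightarrow> degree p \<le> max (degree m) (degree q) \<Longrightarrow>
        op_poly p T x = (\<Sum>d\<in>D. (complex_of_real (poly p (Re (cinner (T d) d))) * cinner x d) *\<^sub>C d)"
    define l where "l d = Re (cinner (T d) d)" for d
    have l: "l d \<in> {0..norm T}" if "d \<in> D" for d using eig[OF that] by (simp add: l_def)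
    have l_norm: "l d = (norm (A d))\<^sup>2" for d by (simp add: l_def TA Re_cinner_self)
    have q_form: "(\<Sum>d\<in>D. f (l d) * (norm (cinner x d))\<^sup>2) \<le> Re (cinner (fun_calc f T x) x) + 2 * \<eta>"
      if x: "x \<in> {e, C y}" "norm x \<le> 1" for x
    proof -
      have x1: "(norm x)\<^sup>2 \<le> 1" using x(2) by (simp add: power_le_one)
      have "(\<Sum>d\<in>D. f (l d) * (norm (cinner x d))\<^sup>2)
          \<le> (\<Sum>d\<in>D. (poly q (l d) + \<eta>) * (norm (cinner x d))\<^sup>2)"
      proof (intro sum_mono mult_right_mono)
        fix d assume "d \<in> D"
        from q[OF l[OF this]] show "f (l d) \<le> poly q (l d) + \<eta>" by linarith
      qed simp
      also have "\<dots> = (\<Sum>d\<in>D. poly q (l d) * (norm (cinner x d))\<^sup>2) + \<eta> * (\<Sum>d\<in>D. (norm (cinner x d))\<^sup>2)"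
        by (simp add: distrib_right sum.distrib sum_distrib_left)
      also have "(\<Sum>d\<in>D. poly q (l d) * (norm (cinner x d))\<^sup>2) = Re (cinner (op_poly q T x) x)"
        using quad[of x q] x(1) by (auto simp: l_def quadrature_quadratic_form)
      also have "\<dots> \<le> Re (cinner (fun_calc f T x) x) + \<eta> * (norm x)\<^sup>2"
        using fun_calc_quadratic_form[OF T f q, of x] by simp
      also have "\<eta> * (norm x)\<^sup>2 \<le> \<eta> * 1" using \<eta> x1 by (intro mult_left_mono) auto
      also have "\<eta> * (\<Sum>d\<in>D. (norm (cinner x d))\<^sup>2) \<le> \<eta> * 1"
        using \<eta> x1 bessel_inequality[OF D(2,1), of x] by (intro mult_left_mono) auto
      finally show ?thesis by simp
    qed
    \<comment> \<open>\<open>v d\<close> is the modulus of the coefficient of \<open>y\<close> at the left singular vector of \<open>d\<close>. For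
      \<open>A d = 0\<close> the coefficient of \<open>b\<close> vanishes, and the value zero keeps \<open>c_eq\<close> true.\<close>
    define a where "a d = norm (cinner e d)" for d
    define v where "v d = (if A d = 0 then 0 else norm (cinner b d) / norm (A d))" for d
    have bd: "cinner b d = cinner y (A d)" for d
      by (simp add: b_def cinner_hilbert_adjoint_left[OF A])
    have c_eq: "norm (cinner b d) = sqrt (l d) * v d" for d
      by (simp add: v_def bd l_norm)
    have a_sum: "(\<Sum>d\<in>D. (a d)\<^sup>2) \<le> 1"
    proof -
      have "(\<Sum>d\<in>D. (a d)\<^sup>2) \<le> (norm e)\<^sup>2" unfolding a_def by (rule bessel_inequality[OF D(2,1)])
      also have "\<dots> \<le> 1" using e by (simp add: power_le_one)
      finally show ?thesis .
    qed
    have v_sum: "(\<Sum>d\<in>D. (v d)\<^sup>2) \<le> 1"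
    proof -
      let ?D = "{d \<in> D. A d \<noteq> 0}"
      have on: "orthonormal_on ?D (\<lambda>d. (1 / norm (A d)) *\<^sub>R A d)"
        by (rule orthonormal_singular_vectors[OF A]) (use diag in \<open>simp add: T_def\<close>)
      have "(\<Sum>d\<in>D. (v d)\<^sup>2) = (\<Sum>d\<in>?D. (v d)\<^sup>2)"
        by (rule sum.mono_neutral_right) (use D in \<open>auto simp: v_def\<close>)
      also have "\<dots> = (\<Sum>d\<in>?D. (norm (cinner y ((1 / norm (A d)) *\<^sub>R A d)))\<^sup>2)"
        by (rule sum.cong[OF refl]) (simp add: v_def bd cinner_scaleR_right norm_mult norm_divide)
      also have "\<dots> \<le> (norm y)\<^sup>2" by (rule bessel_inequality[OF on]) (use D in simp)
      also have "\<dots> \<le> 1" using y by (simp add: power_le_one)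
      finally show ?thesis .
    qed
    define w where "w d = ((a d)\<^sup>2 + (v d)\<^sup>2) / 2" for d
    have w_sum: "sum w D \<le> 1"
      using a_sum v_sum by (simp add: w_def sum_divide_distrib[symmetric] sum.distrib)
    have b_eq: "b = (\<Sum>d\<in>D. cinner b d *\<^sub>C d)" and e_eq: "e = (\<Sum>d\<in>D. cinner e d *\<^sub>C d)"
      using quad[of b 1] quad[of e 1] by (simp_all add: b_def op_poly_one)
    have "norm (cinner (A e) y) = norm (cinner e b)"
      by (simp add: b_def cinner_hilbert_adjoint_right[OF A])
    also have "cinner e b = (\<Sum>d\<in>D. cinner e d * cnj (cinner b d))"
      using cinner_orthonormal_sums[OF D(2,1), of "\<lambda>d. cinner e d" "\<lambda>d. cinner b d"]
      by (simp flip: b_eq e_eq)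
    also have "norm \<dots> \<le> (\<Sum>d\<in>D. norm (cinner e d * cnj (cinner b d)))" by (rule norm_sum)
    also have "\<dots> = (\<Sum>d\<in>D. a d * v d * sqrt (l d))"
      by (simp add: norm_mult c_eq a_def mult_ac)
    also have "\<dots> \<le> (\<Sum>d\<in>D. w d * sqrt (l d))"
    proof (intro sum_mono mult_right_mono)
      fix d assume "d \<in> D"
      have "0 \<le> (a d - v d)\<^sup>2" by simp
      then show "a d * v d \<le> w d" by (simp add: w_def power2_diff)
    qed (use l in \<open>auto simp: l_norm\<close>)
    finally have "norm (cinner (A e) y) powr r \<le> (\<Sum>d\<in>D. w d * sqrt (l d)) powr r"
      using r by (intro powr_mono2) auto
    also have "\<dots> \<le> (\<Sum>d\<in>D. w d * sqrt (l d) powr r)"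
      by (rule subprobability_jensen_powr[OF r _ w_sum]) (auto simp: w_def l_norm)
    also have "\<dots> = (\<Sum>d\<in>D. w d * f (l d))"
      using l by (intro sum.cong[OF refl]) (auto simp: f_def powr_half_sqrt[symmetric] powr_powr)
    also have "\<dots> = ((\<Sum>d\<in>D. f (l d) * (a d)\<^sup>2) + (\<Sum>d\<in>D. f (l d) * (v d)\<^sup>2)) / 2"
      by (simp add: w_def sum.distrib[symmetric] sum_divide_distrib algebra_simps add_divide_distrib)
    also have "(\<Sum>d\<in>D. f (l d) * (a d)\<^sup>2) \<le> Re (cinner (fun_calc f T e) e) + 2 * \<eta>"
      unfolding a_def by (rule q_form) (use e in auto)
    also have "(\<Sum>d\<in>D. f (l d) * (v d)\<^sup>2) \<le> (Re (cinner (fun_calc f T (C y)) (C y)) + 2 * \<eta>) + \<eta>"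
    proof -
      have Cy: "norm (cinner (C y) d) = \<bar>poly m (l d)\<bar> * norm (cinner b d)" if "d \<in> D" for d
        using quad[of b m] cinner_orthonormal_sum[OF D(2,1) that]
        by (simp add: C_def b_def l_def norm_mult)
      have "(\<Sum>d\<in>D. f (l d) * (v d)\<^sup>2) \<le> (\<Sum>d\<in>D. f (l d) * (norm (cinner (C y) d))\<^sup>2 + \<eta> * (v d)\<^sup>2)"
      proof (rule sum_mono)
        fix d assume d: "d \<in> D"
        have l0: "0 \<le> l d" by (simp add: l_norm)
        have "f (l d) * (1 - l d * (poly m (l d))\<^sup>2) * (v d)\<^sup>2 \<le> \<eta> * (v d)\<^sup>2"
          by (intro mult_right_mono m2 l d) simp
        moreover have "(norm (cinner (C y) d))\<^sup>2 = l d * (poly m (l d))\<^sup>2 * (v d)\<^sup>2"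
          using l0 by (simp add: Cy[OF d] c_eq power_mult_distrib)
        ultimately show "f (l d) * (v d)\<^sup>2 \<le> f (l d) * (norm (cinner (C y) d))\<^sup>2 + \<eta> * (v d)\<^sup>2"
          by (simp add: algebra_simps)
      qed
      also have "\<dots> = (\<Sum>d\<in>D. f (l d) * (norm (cinner (C y) d))\<^sup>2) + \<eta> * (\<Sum>d\<in>D. (v d)\<^sup>2)"
        by (simp add: sum.distrib sum_distrib_left)
      also have "(\<Sum>d\<in>D. f (l d) * (norm (cinner (C y) d))\<^sup>2)
          \<le> Re (cinner (fun_calc f T (C y)) (C y)) + 2 * \<eta>"
        by (rule q_form) (use C_le[of y] y in auto)
      also have "\<eta> * (\<Sum>d\<in>D. (v d)\<^sup>2) \<le> \<eta> * 1" using \<eta> v_sum by (intro mult_left_mono) auto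
      finally show ?thesis by simp
    qed
    finally show "norm (cinner (A e) y) powr r \<le>
        (Re (cinner (fun_calc f T e) e) + Re (cinner (fun_calc f T (C y)) (C y))) / 2 + 3 * \<eta>"
      using \<eta> by (simp add: field_simps)
  qed simp
  then show thesis using that[OF V_le VC] by (simp add: R)
qed

text \<open>Both means in the previous bound sum to at most the trace, since \<open>u\<close> is orthonormal and the
  contraction \<open>V\<close> gives Bessel's inequality for the images \<open>C (v i)\<close>.\<close>

lemma matrix_elements_le_trace:
  fixes A :: "'a :: complex_hilbert \<Rightarrow>\<^sub>L 'b :: complex_hilbert"
  assumes A: "A \<in> bounded_ops" and r: "1 \<le> r" and E: "orthonormal_basis E" and I: "finite I"
    and u: "orthonormal_on I u" and v: "orthonormal_on I v"
  shows "ennreal (\<Sum>i\<in>I. norm (cinner (A (u i)) (v i)) powr r)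
    \<le> (\<Sum>\<^sub>\<infinity>e\<in>E. ennreal (Re (cinner (abs_op_powr A r e) e)))" (is "_ \<le> ?tr")
proof (cases ?tr)
  case (real t)
  let ?R = "abs_op_powr A r"
  have R: "positive_op ?R" using positive_op_abs_op_powr[OF A] r by simp
  have "(\<Sum>i\<in>I. norm (cinner (A (u i)) (v i)) powr r) \<le> t + \<epsilon>" if \<epsilon>: "0 < \<epsilon>" for \<epsilon>
  proof -
    define \<eta> where "\<eta> = \<epsilon> / (3 * (card I + 1))"
    have \<eta>: "0 < \<eta>" using \<epsilon> by (simp add: \<eta>_def)
    have card: "real (card I) * (3 * \<eta>) \<le> \<epsilon>" using \<epsilon> by (simp add: \<eta>_def field_simps)
    from matrix_element_powr_bound[OF A r \<eta>] obtain V C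
      where V: "\<And>x. norm (V x) \<le> norm x" and VC: "\<And>x f. cinner (V x) f = cinner x (C f)"
        and bound: "\<And>e f. norm e \<le> 1 \<Longrightarrow> norm f \<le> 1 \<Longrightarrow> norm (cinner (A e) f) powr r \<le>
          (Re (cinner (?R e) e) + Re (cinner (?R (C f)) (C f))) / 2 + 3 * \<eta>"
      by blast
    have bessel_C: "(\<Sum>i\<in>I. (norm (cinner x (C (v i))))\<^sup>2) \<le> (norm x)\<^sup>2" for x
    proof -
      have "(\<Sum>i\<in>I. (norm (cinner x (C (v i))))\<^sup>2) \<le> (norm (V x))\<^sup>2"
        using bessel_inequality[OF v I] by (simp add: VC[symmetric])
      also have "\<dots> \<le> (norm x)\<^sup>2" using V by (simp add: power_mono)
      finally show ?thesis .
    qed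
    have "(\<Sum>i\<in>I. Re (cinner (?R (u i)) (u i))) \<le> t"
      using bessel_sum_le_trace[OF R E I, of u] bessel_inequality[OF u I] real by simp
    moreover have "(\<Sum>i\<in>I. Re (cinner (?R (C (v i))) (C (v i)))) \<le> t"
      using bessel_sum_le_trace[OF R E I, of "\<lambda>i. C (v i)"] bessel_C real by simp
    moreover have "(\<Sum>i\<in>I. norm (cinner (A (u i)) (v i)) powr r) \<le> (\<Sum>i\<in>I.
        (Re (cinner (?R (u i)) (u i)) + Re (cinner (?R (C (v i))) (C (v i)))) / 2 + 3 * \<eta>)"
      by (intro sum_mono bound) (simp_all add: orthonormal_on_norm[OF u] orthonormal_on_norm[OF v])
    then have "(\<Sum>i\<in>I. norm (cinner (A (u i)) (v i)) powr r) \<le> ((\<Sum>i\<in>I. Re (cinner (?R (u i)) (u i)))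
        + (\<Sum>i\<in>I. Re (cinner (?R (C (v i))) (C (v i))))) / 2 + real (card I) * (3 * \<eta>)"
      by (simp add: sum.distrib sum_divide_distrib[symmetric])
    moreover have "x \<le> t + \<epsilon>"
      if "s1 \<le> t" "s2 \<le> t" "x \<le> (s1 + s2) / 2 + y" "y \<le> \<epsilon>" for x y s1 s2 :: real
      using that by (simp add: field_simps)
    ultimately show ?thesis using card by blast
  qed
  then have "(\<Sum>i\<in>I. norm (cinner (A (u i)) (v i)) powr r) \<le> t" by (rule field_le_epsilon)
  then show ?thesis using real by (simp add: ennreal_leI)
qed simp

text \<open>The matching lower bound: diagonalise a Krylov compression containing \<open>E\<close> and test with its
  singular vectors, which makes the matrix elements equal to its singular values.\<close>

lemma trace_le_matrix_elements:
  fixes A :: "'a :: complex_hilbert \<Rightarrow>\<^sub>L 'b :: complex_hilbert"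
  assumes A: "A \<in> bounded_ops" and r: "0 < r" and E: "finite E" "orthonormal_on E (\<lambda>e. e)"
    and \<epsilon>: "0 < \<epsilon>"
  obtains D u where "finite D" "orthonormal_on D (\<lambda>d. d)" "orthonormal_on D u"
    and "(\<Sum>e\<in>E. Re (cinner (abs_op_powr A r e) e)) \<le> (\<Sum>d\<in>D. norm (cinner (A d) (u d)) powr r) + \<epsilon>"
proof -
  define T where "T = hilbert_adjoint A o\<^sub>L A"
  have T: "positive_op T" unfolding T_def by (rule positive_op_adjoint_comp[OF A])
  have TA: "cinner (T x) y = cinner (A x) (A y)" for x y
    unfolding T_def by (rule cinner_adjoint_comp[OF A])
  define f where "f t = t powr (r / 2)" for t :: real
  have f: "continuous_on {0..norm T} f" unfolding f_def using r by (intro continuous_on_powr_half) simp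
  have R: "abs_op_powr A r = fun_calc f T" by (simp add: abs_op_powr_def T_def f_def[abs_def])
  define \<eta> where "\<eta> = \<epsilon> / (2 * (card E + 1))"
  have \<eta>: "0 < \<eta>" using \<epsilon> by (simp add: \<eta>_def)
  have card: "real (card E) * (2 * \<eta>) \<le> \<epsilon>" using \<epsilon> by (simp add: \<eta>_def field_simps)
  obtain q where q: "\<And>t. t \<in> {0..norm T} \<Longrightarrow> \<bar>poly q t - f t\<bar> \<le> \<eta>"
    using weierstrass_poly[OF f \<eta>] by blast
  show thesis
  proof (rule krylov_quadrature[OF T E(1), where n = "degree q"])
    fix D assume D: "finite D" "orthonormal_on D (\<lambda>d. d)"
      and diag: "\<And>d d'. d \<in> D \<Longrightarrow> d' \<in> D \<Longrightarrow> d \<noteq> d' \<Longrightarrow> cinner (T d) d' = 0"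
      and eig: "\<And>d. d \<in> D \<Longrightarrow> Re (cinner (T d) d) \<in> {0..norm T}"
      and quad: "\<And>x p. x \<in> E \<Longrightarrow> degree p \<le> degree q \<Longrightarrow>
        op_poly p T x = (\<Sum>d\<in>D. (complex_of_real (poly p (Re (cinner (T d) d))) * cinner x d) *\<^sub>C d)"
    define l where "l d = Re (cinner (T d) d)" for d
    have l: "l d \<in> {0..norm T}" if "d \<in> D" for d using eig[OF that] by (simp add: l_def)
    have l_norm: "l d = (norm (A d))\<^sup>2" for d by (simp add: l_def TA Re_cinner_self)
    have f0: "0 \<le> f t" for t by (simp add: f_def)
    define D1 where "D1 = {d \<in> D. A d \<noteq> 0}"
    define u where "u d = (1 / norm (A d)) *\<^sub>R A d" for d
    have on_u: "orthonormal_on D1 u"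
      unfolding D1_def u_def by (rule orthonormal_singular_vectors[OF A]) (use diag in \<open>simp add: T_def\<close>)
    have Au: "norm (cinner (A d) (u d)) powr r = f (l d)" if "d \<in> D1" for d
    proof -
      have "cinner (A d) (u d) = complex_of_real (norm (A d))"
        using that by (simp add: u_def D1_def cinner_scaleR_right cinner_self power2_eq_square)
      moreover have "f (l d) = norm (A d) powr r"
        using that by (simp add: f_def l_norm D1_def powr_powr flip: powr_numeral)
      ultimately show ?thesis by simp
    qed
    have "(\<Sum>e\<in>E. Re (cinner (fun_calc f T e) e)) \<le> (\<Sum>e\<in>E. (\<Sum>d\<in>D. f (l d) * (norm (cinner e d))\<^sup>2) + 2 * \<eta>)"
    proof (rule sum_mono)
      fix e assume e: "e \<in> E"
      have e1: "norm e = 1" using orthonormal_on_norm[OF E(2) e] by simp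
      have "Re (cinner (fun_calc f T e) e) \<le> Re (cinner (op_poly q T e) e) + \<eta>"
        using fun_calc_quadratic_form[OF T f q, of e] e1 by simp
      also have "Re (cinner (op_poly q T e) e) = (\<Sum>d\<in>D. poly q (l d) * (norm (cinner e d))\<^sup>2)"
        using quad[OF e order_refl] by (simp add: l_def quadrature_quadratic_form)
      also have "\<dots> \<le> (\<Sum>d\<in>D. (f (l d) + \<eta>) * (norm (cinner e d))\<^sup>2)"
      proof (intro sum_mono mult_right_mono)
        fix d assume "d \<in> D"
        from q[OF l[OF this]] show "poly q (l d) \<le> f (l d) + \<eta>" by linarith
      qed simp
      also have "\<dots> = (\<Sum>d\<in>D. f (l d) * (norm (cinner e d))\<^sup>2) + \<eta> * (\<Sum>d\<in>D. (norm (cinner e d))\<^sup>2)"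
        by (simp add: distrib_right sum.distrib sum_distrib_left)
      also have "\<eta> * (\<Sum>d\<in>D. (norm (cinner e d))\<^sup>2) \<le> \<eta> * 1"
        using \<eta> bessel_inequality[OF D(2,1), of e] e1 by (intro mult_left_mono) auto
      finally show "Re (cinner (fun_calc f T e) e)
          \<le> (\<Sum>d\<in>D. f (l d) * (norm (cinner e d))\<^sup>2) + 2 * \<eta>" by simp
    qed
    also have "\<dots> = (\<Sum>e\<in>E. \<Sum>d\<in>D. f (l d) * (norm (cinner e d))\<^sup>2) + real (card E) * (2 * \<eta>)"
      by (simp add: sum.distrib)
    also have "(\<Sum>e\<in>E. \<Sum>d\<in>D. f (l d) * (norm (cinner e d))\<^sup>2)
        = (\<Sum>d\<in>D. f (l d) * (\<Sum>e\<in>E. (norm (cinner d e))\<^sup>2))"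
      by (subst sum.swap) (simp add: sum_distrib_left norm_cinner_commute)
    also have "\<dots> \<le> (\<Sum>d\<in>D. f (l d) * 1)"
    proof (intro sum_mono mult_left_mono f0)
      fix d assume "d \<in> D"
      then show "(\<Sum>e\<in>E. (norm (cinner d e))\<^sup>2) \<le> 1"
        using bessel_inequality[OF E(2,1), of d] orthonormal_on_norm[OF D(2)] by simp
    qed
    also have "(\<Sum>d\<in>D. f (l d) * 1) = (\<Sum>d\<in>D1. f (l d))"
      unfolding mult_1_right
      by (rule sum.mono_neutral_right) (use D in \<open>auto simp: D1_def l_norm f_def\<close>)
    also have "\<dots> = (\<Sum>d\<in>D1. norm (cinner (A d) (u d)) powr r)" by (simp add: Au)
    finally have "(\<Sum>e\<in>E. Re (cinner (abs_op_powr A r e) e))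
        \<le> (\<Sum>d\<in>D1. norm (cinner (A d) (u d)) powr r) + \<epsilon>"
      using card by (simp add: R)
    moreover have "orthonormal_on D1 (\<lambda>d. d)" using D(2) by (simp add: orthonormal_on_def D1_def)
    moreover have "finite D1" using D(1) by (simp add: D1_def)
    ultimately show thesis using that on_u by blast
  qed
qed

section \<open>Existence of the pointwise Pettis integral\<close>

text \<open>By Baire's theorem some sublevel set contains a ball.\<close>

lemma lsc_seminorm_bounded:
  fixes N :: "'a :: banach \<Rightarrow> real"
  assumes add: "\<And>x y. N (x + y) \<le> N x + N y" and scale: "\<And>c x. N (c *\<^sub>R x) \<le> \<bar>c\<bar> * N x"
    and lsc: "\<And>c. closed {x. N x \<le> c}"
  obtains K where "0 \<le> K" "\<And>x. N x \<le> K * norm x"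
proof -
  let ?G = "range (\<lambda>n :: nat. {x. N x \<le> real n})"
  have "\<Union>?G = UNIV" using real_arch_simple by auto
  have "\<exists>n :: nat. interior {x. N x \<le> real n} \<noteq> {}"
  proof (rule ccontr)
    assume "\<not> ?thesis"
    then have "euclidean interior_of \<Union>?G = {}"
      using lsc by (intro Baire_category_alt) (auto simp: completely_metrizable_space_euclidean)
    with \<open>\<Union>?G = UNIV\<close> show False by simp
  qed
  then obtain n :: nat and x0 where "x0 \<in> interior {x. N x \<le> real n}" by blast
  then obtain e where e: "0 < e" and ball: "\<And>x. dist x0 x < e \<Longrightarrow> N x \<le> real n"
    unfolding mem_interior by (auto simp: subset_eq)
  have small: "N x \<le> 2 * real n" if "norm x < e" for x
  proof -
    have "N (x0 + x) \<le> real n" using that by (intro ball) (simp add: dist_norm)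
    moreover have "N (- x0) \<le> N x0" using scale[of "-1" x0] by simp
    moreover have "N x0 \<le> real n" using e by (intro ball) simp
    moreover have "N x \<le> N (x0 + x) + N (- x0)" using add[of "x0 + x" "- x0"] by simp
    ultimately show ?thesis by simp
  qed
  have "N x \<le> (4 * real n / e) * norm x" for x
  proof (cases "x = 0")
    case True
    then show ?thesis using scale[of 0 x] by simp
  next
    case False
    define y where "y = (e / (2 * norm x)) *\<^sub>R x"
    have "norm y = e / 2" using False e by (simp add: y_def)
    then have "N y \<le> 2 * real n" using e by (intro small) simp
    have "x = (2 * norm x / e) *\<^sub>R y" using False e by (simp add: y_def)
    then have "N x \<le> \<bar>2 * norm x / e\<bar> * N y" using scale by metis
    also have "\<dots> \<le> \<bar>2 * norm x / e\<bar> * (2 * real n)"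
      using \<open>N y \<le> 2 * real n\<close> by (rule mult_left_mono) simp
    finally show ?thesis using e by (simp add: mult_ac)
  qed
  then show thesis using e by (intro that[of "4 * real n / e"]) auto
qed

lemma integral_norm_le_of_pointwise_limit:
  fixes \<phi> :: "nat \<Rightarrow> 's \<Rightarrow> complex"
  assumes int: "\<And>n. integrable M (\<phi> n)" "integrable M \<psi>"
    and lim: "\<And>s. (\<lambda>n. \<phi> n s) \<longlonglongrightarrow> \<psi> s" and le: "\<And>n. (LINT s|M. norm (\<phi> n s)) \<le> c"
  shows "(LINT s|M. norm (\<psi> s)) \<le> c"
proof -
  have c: "0 \<le> c" using le[of 0] by (rule order_trans[rotated]) simp
  have "ennreal (LINT s|M. norm (\<psi> s)) = (\<integral>\<^sup>+ s. ennreal (norm (\<psi> s)) \<partial>M)"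
    using int by (simp add: nn_integral_eq_integral)
  also have "\<dots> = (\<integral>\<^sup>+ s. liminf (\<lambda>n. ennreal (norm (\<phi> n s))) \<partial>M)"
  proof (rule nn_integral_cong)
    fix s
    have "(\<lambda>n. ennreal (norm (\<phi> n s))) \<longlonglongrightarrow> ennreal (norm (\<psi> s))"
      by (intro tendsto_intros lim)
    then show "ennreal (norm (\<psi> s)) = liminf (\<lambda>n. ennreal (norm (\<phi> n s)))"
      by (rule lim_imp_Liminf[OF sequentially_bot, symmetric])
  qed
  also have "\<dots> \<le> liminf (\<lambda>n. \<integral>\<^sup>+ s. ennreal (norm (\<phi> n s)) \<partial>M)"
    using int by (intro nn_integral_liminf) auto
  also have "\<dots> \<le> liminf (\<lambda>n :: nat. ennreal c)"
  proof (rule Liminf_mono, rule always_eventually, rule allI)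
    fix n
    have "(\<integral>\<^sup>+ s. ennreal (norm (\<phi> n s)) \<partial>M) = ennreal (LINT s|M. norm (\<phi> n s))"
      using int by (simp add: nn_integral_eq_integral)
    then show "(\<integral>\<^sup>+ s. ennreal (norm (\<phi> n s)) \<partial>M) \<le> ennreal c" using le by (simp add: ennreal_leI)
  qed
  also have "\<dots> = ennreal c" by (simp add: Liminf_const)
  finally show ?thesis using c by simp
qed

text \<open>The \<open>L\<^sup>1\<close> seminorm of \<open>\<langle>F h, k\<rangle>\<close> is lower semicontinuous in \<open>k\<close> by Fatou's lemma, hence bounded
  in \<open>k\<close>; its supremum over the unit ball of \<open>k\<close> is then lower semicontinuous in \<open>h\<close>.\<close>

lemma Pettis_L1_bound:
  fixes F :: "'s \<Rightarrow> 'a :: complex_hilbert \<Rightarrow>\<^sub>L 'b :: complex_hilbert"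
  assumes F: "pointwise_Pettis_integrable M F"
  obtains K where "0 \<le> K" "\<And>h k. (LINT s|M. norm (cinner (F s h) k)) \<le> K * norm h * norm k"
proof -
  have int: "integrable M (\<lambda>s. cinner (F s h) k)" for h k
    using F by (simp add: pointwise_Pettis_integrable_def)
  define N where "N h k = (LINT s|M. norm (cinner (F s h) k))" for h k
  have N_add_right: "N h (k + k') \<le> N h k + N h k'" for h k k'
    unfolding N_def Bochner_Integration.integral_add[OF integrable_norm[OF int] integrable_norm[OF int], symmetric]
    by (intro integral_mono integrable_norm int Bochner_Integration.integrable_add)
      (simp add: cinner_add_right norm_triangle_ineq)
  have N_add_left: "N (h + h') k \<le> N h k + N h' k" for h h' k
    unfolding N_def Bochner_Integration.integral_add[OF integrable_norm[OF int] integrable_norm[OF int], symmetric]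
    by (intro integral_mono integrable_norm int Bochner_Integration.integrable_add)
      (simp add: blinfun.add_right cinner_add_left norm_triangle_ineq)
  have N_scale_right: "N h (c *\<^sub>R k) = \<bar>c\<bar> * N h k" for h k c
    by (simp add: N_def cinner_scaleR_right norm_mult)
  have N_scale_left: "N (c *\<^sub>R h) k = \<bar>c\<bar> * N h k" for h k c
    by (simp add: N_def blinfun.scaleR_right cinner_scaleR_left norm_mult)
  have closed_right: "closed {k. N h k \<le> c}" for h c
    unfolding closed_sequential_limits
  proof (intro allI impI)
    fix x l assume x: "(\<forall>n. x n \<in> {k. N h k \<le> c}) \<and> x \<longlonglongrightarrow> l"
    have "N h l \<le> c"
      unfolding N_def
      by (rule integral_norm_le_of_pointwise_limit[where \<phi> = "\<lambda>n s. cinner (F s h) (x n)"])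
        (use x in \<open>auto intro!: int tendsto_intros simp: N_def\<close>)
    then show "l \<in> {k. N h k \<le> c}" by simp
  qed
  have closed_left: "closed {h. N h k \<le> c}" for k c
    unfolding closed_sequential_limits
  proof (intro allI impI)
    fix x l assume x: "(\<forall>n. x n \<in> {h. N h k \<le> c}) \<and> x \<longlonglongrightarrow> l"
    have "N l k \<le> c"
      unfolding N_def
      by (rule integral_norm_le_of_pointwise_limit[where \<phi> = "\<lambda>n s. cinner (F s (x n)) k"])
        (use x in \<open>auto intro!: int tendsto_intros simp: N_def\<close>)
    then show "l \<in> {h. N h k \<le> c}" by simp
  qed
  have "\<exists>K. 0 \<le> K \<and> (\<forall>k. N h k \<le> K * norm k)" for h
    by (rule lsc_seminorm_bounded[of "N h"])
      (use N_add_right N_scale_right closed_right in \<open>auto intro: eq_refl\<close>)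
  then obtain K1 where K1: "\<And>h. 0 \<le> K1 h" "\<And>h k. N h k \<le> K1 h * norm k" by metis
  define C where "C h = (SUP k\<in>cball 0 1. N h k)" for h
  have bdd: "bdd_above (N h ` cball 0 1)" for h
  proof (rule bdd_aboveI2)
    fix k :: 'b assume "k \<in> cball 0 1"
    then have "K1 h * norm k \<le> K1 h * 1" using K1(1) by (intro mult_left_mono) auto
    then show "N h k \<le> K1 h" using K1(2)[of h k] by simp
  qed
  have N_le_C: "N h k \<le> C h" if "norm k \<le> 1" for h k
    unfolding C_def using that by (intro cSUP_upper bdd) simp
  have C_le: "C h \<le> c \<longleftrightarrow> (\<forall>k\<in>cball 0 1. N h k \<le> c)" for h c
    unfolding C_def by (rule cSUP_le_iff[OF _ bdd]) auto
  obtain K where K: "0 \<le> K" "\<And>h. C h \<le> K * norm h"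
  proof (rule lsc_seminorm_bounded[of C])
    show "C (x + y) \<le> C x + C y" for x y
      unfolding C_le by (intro ballI order_trans[OF N_add_left] add_mono N_le_C) simp_all
    show "C (c *\<^sub>R x) \<le> \<bar>c\<bar> * C x" for c x
      unfolding C_le N_scale_left by (intro ballI mult_left_mono N_le_C) simp_all
    have "{h. C h \<le> c} = (\<Inter>k\<in>cball 0 1. {h. N h k \<le> c})" for c by (auto simp: C_le)
    then show "closed {h. C h \<le> c}" for c using closed_left by auto
  qed (rule that)
  have "N h k \<le> K * norm h * norm k" for h k
  proof (cases "k = 0")
    case True
    then show ?thesis by (simp add: N_def)
  next
    case False
    have "N h k = norm k * N h ((1 / norm k) *\<^sub>R k)" using False by (simp add: N_scale_right)
    also have "\<dots> \<le> norm k * (K * norm h)"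
      using False by (intro mult_left_mono order_trans[OF N_le_C K(2)]) auto
    finally show ?thesis by (simp add: mult_ac)
  qed
  then show thesis using that K(1) by (simp add: N_def)
qed

lemma Pettis_integral:
  fixes F :: "'s \<Rightarrow> 'a :: complex_hilbert \<Rightarrow>\<^sub>L 'b :: complex_hilbert"
  assumes F_ops: "\<And>s. s \<in> space M \<Longrightarrow> F s \<in> bounded_ops"
    and F: "pointwise_Pettis_integrable M F"
  shows "Pettis_integral M F \<in> bounded_ops \<and>
    (\<forall>h k. cinner (Pettis_integral M F h) k = (LINT s|M. cinner (F s h) k))"
proof -
  have int: "integrable M (\<lambda>s. cinner (F s h) k)" for h k
    using F by (simp add: pointwise_Pettis_integrable_def)
  have int_re: "integrable M (\<lambda>s. inner (F s h) k)" for h k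
    using integrable_Re[OF int[of h k]] by (simp add: Re_cinner)
  obtain K where K: "0 \<le> K" "\<And>h k. (LINT s|M. norm (cinner (F s h) k)) \<le> K * norm h * norm k"
    using Pettis_L1_bound[OF F] by blast
  define b where "b h k = (LINT s|M. inner (F s h) k)" for h k
  have "bounded_bilinear b"
  proof
    show "b (h + h') k = b h k + b h' k" for h h' k
      by (simp add: b_def blinfun.add_right inner_add_left int_re)
    show "b h (k + k') = b h k + b h k'" for h k k'
      by (simp add: b_def inner_add_right int_re)
    show "b (c *\<^sub>R h) k = c *\<^sub>R b h k" for c h k
      by (simp add: b_def blinfun.scaleR_right)
    show "b h (c *\<^sub>R k) = c *\<^sub>R b h k" for c h k
      by (simp add: b_def)
    have "norm (b h k) \<le> norm h * norm k * K" for h k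
    proof -
      have "norm (b h k) \<le> (LINT s|M. norm (inner (F s h) k))"
        unfolding b_def by (rule integral_norm_bound)
      also have "\<dots> \<le> (LINT s|M. norm (cinner (F s h) k))"
        by (intro integral_mono integrable_norm int int_re)
          (simp add: Re_cinner[symmetric] abs_Re_le_cmod)
      finally show ?thesis using K(2)[of h k] by (simp add: mult_ac)
    qed
    then show "\<exists>K. \<forall>h k. norm (b h k) \<le> norm h * norm k * K" by blast
  qed
  from bounded_bilinear_representation[OF this] obtain S :: "'a \<Rightarrow>\<^sub>L 'b"
    where S: "\<And>h k. inner (S h) k = b h k" by blast
  have S_int: "cinner (S h) k = (LINT s|M. cinner (F s h) k)" for h k
  proof (rule complex_eqI)
    show "Re (cinner (S h) k) = Re (LINT s|M. cinner (F s h) k)"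
      using integral_bounded_linear[OF bounded_linear_Re int[of h k]] by (simp add: Re_cinner S b_def)
    show "Im (cinner (S h) k) = Im (LINT s|M. cinner (F s h) k)"
      using integral_bounded_linear[OF bounded_linear_Im int[of h k]] by (simp add: Im_cinner S b_def)
  qed
  have "S (c *\<^sub>C h) = c *\<^sub>C S h" for c h
  proof (rule cinner_ext)
    fix k
    have "cinner (S (c *\<^sub>C h)) k = (LINT s|M. c * cinner (F s h) k)"
      unfolding S_int
      by (rule Bochner_Integration.integral_cong)
        (simp_all add: bounded_ops_scaleC[OF F_ops] cinner_scaleC_left)
    then show "cinner (S (c *\<^sub>C h)) k = cinner (c *\<^sub>C S h) k"
      by (simp add: cinner_scaleC_left S_int)
  qed
  then have "S \<in> bounded_ops" by (simp add: bounded_ops_def)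
  moreover have "S' = S"
    if "\<forall>h k. cinner (S' h) k = (LINT s|M. cinner (F s h) k)" for S' :: "'a \<Rightarrow>\<^sub>L 'b"
    by (rule blinfun_eqI, rule cinner_ext) (simp add: that S_int)
  ultimately have "\<exists>!S. S \<in> bounded_ops \<and> (\<forall>h k. cinner (S h) k = (LINT s|M. cinner (F s h) k))"
    using S_int by blast
  from theI'[OF this] show ?thesis unfolding Pettis_integral_def .
qed

section \<open>Norms of Pettis integrals\<close>

lemma nn_integral_le_lower_integral:
  assumes "g \<in> borel_measurable M" "\<And>s. s \<in> space M \<Longrightarrow> g s \<le> h s"
  shows "(\<integral>\<^sup>+ s. g s \<partial>M) \<le> lower_integral M h"
  unfolding lower_integral_def using assms by (intro SUP_upper) auto

lemma operator_norm_Pettis_integral_le: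
  fixes F :: "'s \<Rightarrow> 'a :: complex_hilbert \<Rightarrow>\<^sub>L 'b :: complex_hilbert"
  assumes F_ops: "\<And>s. s \<in> space M \<Longrightarrow> F s \<in> bounded_ops"
    and F: "pointwise_Pettis_integrable M F"
  shows "ennreal (norm (Pettis_integral M F)) \<le> lower_integral M (\<lambda>s. ennreal (norm (F s)))"
    (is "_ \<le> ?L")
proof (cases ?L)
  case (real l)
  let ?S = "Pettis_integral M F"
  have int: "integrable M (\<lambda>s. cinner (F s h) k)" for h k
    using F by (simp add: pointwise_Pettis_integrable_def)
  have "norm ?S \<le> l"
  proof (rule norm_blinfun_bound)
    fix h
    show "norm (?S h) \<le> l * norm h"
    proof (cases "h = 0 \<or> ?S h = 0")
      case True
      then show ?thesis using real by auto
    next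
      case False
      define h1 where "h1 = (1 / norm h) *\<^sub>R h"
      define k where "k = (1 / norm (?S h)) *\<^sub>R ?S h"
      have h1: "norm h1 = 1" and k: "norm k = 1" using False by (simp_all add: h1_def k_def)
      have "norm (?S h) / norm h = norm (cinner (?S h1) k)"
        using False by (simp add: h1_def k_def blinfun.scaleR_right cinner_scaleR_left
            cinner_scaleR_right cinner_self norm_mult norm_divide power2_eq_square)
      also have "\<dots> \<le> (LINT s|M. norm (cinner (F s h1) k))"
        using Pettis_integral[OF F_ops F] by simp
      finally have "ennreal (norm (?S h) / norm h) \<le> ennreal (LINT s|M. norm (cinner (F s h1) k))"
        by (rule ennreal_leI)
      also have "\<dots> = (\<integral>\<^sup>+ s. ennreal (norm (cinner (F s h1) k)) \<partial>M)"
        using int by (simp add: nn_integral_eq_integral)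
      also have "\<dots> \<le> ?L"
      proof (rule nn_integral_le_lower_integral)
        show "(\<lambda>s. ennreal (norm (cinner (F s h1) k))) \<in> borel_measurable M" using int by auto
        fix s
        show "ennreal (norm (cinner (F s h1) k)) \<le> ennreal (norm (F s))"
          using norm_cinner_le[of "F s h1" k] norm_blinfun[of "F s" h1] h1 k
          by (intro ennreal_leI) simp
      qed
      finally have "norm (?S h) / norm h \<le> l" using real by simp
      then show ?thesis using False by (simp add: divide_le_eq)
    qed
  qed (use real in simp)
  then show ?thesis using real by (simp add: ennreal_leI)
qed simp

text \<open>Minkowski's inequality for the vector of the matrix elements, dualised so that a single
  measurable scalar function, admissible in the lower integral, appears.\<close>

lemma Pettis_matrix_elements_le:
  fixes F :: "'s \<Rightarrow> 'a :: complex_hilbert \<Rightarrow>\<^sub>L 'b :: complex_hilbert"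
  assumes F_ops: "\<And>s. s \<in> space M \<Longrightarrow> F s \<in> bounded_ops"
    and F: "pointwise_Pettis_integrable M F" and r: "1 \<le> r" and E: "orthonormal_basis E"
    and I: "finite I" and u: "orthonormal_on I u" and v: "orthonormal_on I v"
    and l: "lower_integral M (\<lambda>s. ennreal_powr
      (\<Sum>\<^sub>\<infinity>e\<in>E. ennreal (Re (cinner (abs_op_powr (F s) r e) e))) (1 / r)) = ennreal l" "0 \<le> l"
  shows "(\<Sum>i\<in>I. norm (cinner (Pettis_integral M F (u i)) (v i)) powr r) \<le> l powr r"
proof -
  define \<phi> where "\<phi> i s = cinner (F s (u i)) (v i)" for i s
  have int: "integrable M (\<phi> i)" for i
    using F by (simp add: pointwise_Pettis_integrable_def \<phi>_def[abs_def])
  define a where "a i = norm (cinner (Pettis_integral M F (u i)) (v i))" for i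
  have a0: "0 \<le> a i" for i by (simp add: a_def)
  have a_le: "a i \<le> (LINT s|M. norm (\<phi> i s))" for i
    using Pettis_integral[OF F_ops F] by (simp add: a_def \<phi>_def)
  define N where "N = (\<Sum>i\<in>I. a i powr r) powr (1 / r)"
  have N_r: "(\<Sum>i\<in>I. a i powr r) = N powr r"
    using r by (simp add: N_def powr_powr sum_nonneg)
  have "N \<le> l"
  proof (cases "N = 0")
    case False
    then have N: "0 < N" by (simp add: N_def)
    \<comment> \<open>The dual vector of \<open>a\<close>: it attains \<open>\<Sum> c\<^sub>i a\<^sub>i = N\<close>.\<close>
    define c where "c i = (a i / N) powr (r - 1)" for i
    have c0: "0 \<le> c i" for i by (simp add: c_def)
    have "(\<Sum>i\<in>I. c i * a i) = (\<Sum>i\<in>I. a i powr r / N powr (r - 1))"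
    proof (rule sum.cong[OF refl])
      fix i
      show "c i * a i = a i powr r / N powr (r - 1)"
        using a0[of i] N powr_mult_base[of "a i" "r - 1"] by (simp add: c_def powr_divide mult.commute)
    qed
    also have "\<dots> = N powr r / N powr (r - 1)" by (simp add: N_r flip: sum_divide_distrib)
    also have "\<dots> = N" using N by (simp flip: powr_diff)
    finally have "N = (\<Sum>i\<in>I. c i * a i)" by simp
    also have "\<dots> \<le> (\<Sum>i\<in>I. c i * (LINT s|M. norm (\<phi> i s)))"
      by (intro sum_mono mult_left_mono a_le c0)
    also have "\<dots> = (LINT s|M. (\<Sum>i\<in>I. c i * norm (\<phi> i s)))"
      using int by (simp add: integral_sum)
    finally have "ennreal N \<le> ennreal (LINT s|M. (\<Sum>i\<in>I. c i * norm (\<phi> i s)))" by (rule ennreal_leI)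
    also have "\<dots> = (\<integral>\<^sup>+ s. ennreal (\<Sum>i\<in>I. c i * norm (\<phi> i s)) \<partial>M)"
      using int c0 by (intro nn_integral_eq_integral[symmetric]) (auto intro!: sum_nonneg)
    also have "\<dots> \<le> ennreal l"
      unfolding l(1)[symmetric]
    proof (rule nn_integral_le_lower_integral)
      show "(\<lambda>s. ennreal (\<Sum>i\<in>I. c i * norm (\<phi> i s))) \<in> borel_measurable M"
        using borel_measurable_integrable[OF int] by measurable
      fix s assume "s \<in> space M"
      then have Fs: "F s \<in> bounded_ops" by (rule F_ops)
      let ?tr = "\<Sum>\<^sub>\<infinity>e\<in>E. ennreal (Re (cinner (abs_op_powr (F s) r e) e))"
      show "ennreal (\<Sum>i\<in>I. c i * norm (\<phi> i s)) \<le> ennreal_powr ?tr (1 / r)"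
      proof (cases ?tr)
        case (real t)
        have "(\<Sum>i\<in>I. norm (\<phi> i s) powr r) \<le> t"
          using matrix_elements_le_trace[OF Fs r E I u v] real by (simp add: \<phi>_def)
        also have "t = (t powr (1 / r)) powr r" using real r by (simp add: powr_powr)
        finally have "(\<Sum>i\<in>I. c i * norm (\<phi> i s)) \<le> t powr (1 / r)"
          unfolding c_def using N N_r a0 I r by (intro holder_dual_vector) auto
        then show ?thesis using real by (simp add: ennreal_powr_def ennreal_leI)
      qed (simp add: ennreal_powr_def)
    qed
    finally show ?thesis using l(2) by simp
  qed (use l in simp)
  then show ?thesis
    unfolding a_def[symmetric] N_r using r by (intro powr_mono2) (auto simp: N_def)
qed

text \<open>Any finite part of the trace of \<open>|\<integral>F|\<^sup>r\<close> is reached, up to \<open>\<epsilon>\<close>, by finitely many matrix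
  elements, to which the previous bound applies.\<close>

lemma Schatten_powr_Pettis_integral_le:
  fixes F :: "'s \<Rightarrow> 'a :: complex_hilbert \<Rightarrow>\<^sub>L 'b :: complex_hilbert"
  assumes F_ops: "\<And>s. s \<in> space M \<Longrightarrow> F s \<in> bounded_ops"
    and F: "pointwise_Pettis_integrable M F" and r: "1 \<le> r" and E: "orthonormal_basis E"
  shows "ennreal_powr (\<Sum>\<^sub>\<infinity>e\<in>E. ennreal (Re (cinner (abs_op_powr (Pettis_integral M F) r e) e))) (1 / r)
    \<le> lower_integral M (\<lambda>s. ennreal_powr
      (\<Sum>\<^sub>\<infinity>e\<in>E. ennreal (Re (cinner (abs_op_powr (F s) r e) e))) (1 / r))" (is "_ \<le> ?L")
proof (cases ?L)
  case (real l)
  let ?S = "Pettis_integral M F"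
  let ?R = "abs_op_powr ?S r"
  have S: "?S \<in> bounded_ops" using Pettis_integral[OF F_ops F] by simp
  have R: "positive_op ?R" using positive_op_abs_op_powr[OF S] r by simp
  let ?tr = "\<Sum>\<^sub>\<infinity>e\<in>E. ennreal (Re (cinner (?R e) e))"
  have fin: "(\<Sum>e\<in>E0. ennreal (Re (cinner (?R e) e))) \<le> ennreal (l powr r)"
    if E0: "finite E0" "E0 \<subseteq> E" for E0
  proof -
    have on: "orthonormal_on E0 (\<lambda>e. e)"
      using E E0 by (auto simp: orthonormal_basis_iff orthonormal_on_def subset_eq)
    have "(\<Sum>e\<in>E0. Re (cinner (?R e) e)) \<le> l powr r + \<epsilon>" if \<epsilon>: "0 < \<epsilon>" for \<epsilon>
    proof (rule trace_le_matrix_elements[OF S _ E0(1) on \<epsilon>])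
      show "0 < r" using r by simp
      fix D u assume D: "finite D" "orthonormal_on D (\<lambda>d. d)" "orthonormal_on D u"
        and le: "(\<Sum>e\<in>E0. Re (cinner (?R e) e)) \<le> (\<Sum>d\<in>D. norm (cinner (?S d) (u d)) powr r) + \<epsilon>"
      have "(\<Sum>d\<in>D. norm (cinner (?S d) (u d)) powr r) \<le> l powr r"
        using Pettis_matrix_elements_le[OF F_ops F r E D] real by simp
      with le show "(\<Sum>e\<in>E0. Re (cinner (?R e) e)) \<le> l powr r + \<epsilon>" by simp
    qed
    then have "(\<Sum>e\<in>E0. Re (cinner (?R e) e)) \<le> l powr r" by (rule field_le_epsilon)
    then show ?thesis by (simp add: sum_ennreal positive_op_nonneg[OF R] ennreal_leI)
  qed
  have "?tr \<le> ennreal (l powr r)"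
    by (subst nonneg_infsum_complete) (auto intro!: SUP_least fin)
  then obtain t where t: "?tr = ennreal t" "0 \<le> t" "t \<le> l powr r"
    by (cases ?tr) (auto simp: top_unique)
  have "t powr (1 / r) \<le> (l powr r) powr (1 / r)" using t r by (intro powr_mono2) auto
  also have "\<dots> = l" using real r by (simp add: powr_powr)
  finally show ?thesis using t real by (simp add: ennreal_powr_def ennreal_leI)
qed simp

theorem theorem3p4p3:
  fixes M :: "'s measure"
    and F :: "'s \<Rightarrow> 'h :: complex_hilbert \<Rightarrow>\<^sub>L 'k :: complex_hilbert"
    and p :: ennreal
  assumes "\<And>s. s \<in> space M \<Longrightarrow> F s \<in> bounded_ops"
    and "pointwise_Pettis_integrable M F"
    and "1 \<le> p"
  shows "schatten_norm p (Pettis_integral M F) \<le> lower_integral M (\<lambda>s. schatten_norm p (F s)) \<and>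
    (lower_integral M (\<lambda>s. schatten_norm p (F s)) < \<infinity> \<longrightarrow>
      Pettis_integral M F \<in> schatten_class p)"
proof -
  have le: "schatten_norm p (Pettis_integral M F) \<le> lower_integral M (\<lambda>s. schatten_norm p (F s))"
  proof (cases "p = \<infinity>")
    case True
    then show ?thesis
      using operator_norm_Pettis_integral_le[OF assms(1,2)] by (simp add: schatten_norm_def)
  next
    case False
    have "enn2real 1 \<le> enn2real p"
      using False assms(3) by (intro enn2real_mono) (simp_all add: less_top)
    then have r: "1 \<le> enn2real p" by simp
    have E: "orthonormal_basis (SOME E :: 'h set. orthonormal_basis E)"
      using orthonormal_basis_exists by (rule someI_ex)
    show ?thesis
      using False Schatten_powr_Pettis_integral_le[OF assms(1,2) r E] by (simp add: schatten_norm_def)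
  qed
  moreover have "Pettis_integral M F \<in> bounded_ops" using Pettis_integral[OF assms(1,2)] by blast
  ultimately show ?thesis using le_less_trans by (auto simp: schatten_class_def)
qed

end
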